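(* Let $S$ be a finite non-empty set and $\Sigma\subseteq\mathbb{R}_+\times S$ locally finite, and let $(X_n,\eta_n)$ be a time-homogeneous irreducible Markov chain on $\Sigma$ such that every line $\Lambda_k=\{x\in\mathbb{R}_+:(x,k)\in\Sigma\}$ is unbounded. Suppose that for some $p>2$ there is $C_p<\infty$ with $\mathbb{E}_{x,i}[|X_{n+1}-X_n|^p]\le C_p$ for all $(x,i)\in\Sigma$. Assume conditions (Q$_G$) and (D$_G$). Let $\mathbf a=(a_i)_{i\in S}$ be a solution of $d_i+\sum_{j\in S}(a_j-a_i)q_{ij}=0$ for all $i\in S$, and define \[U:=\sum_{i\in S}\Big(2e_i+2\sum_{j\in S}a_j\gamma_{ij}\Big)\pi_i,\qquad V:=\sum_{i\in S}\Big(t_i^2+2\sum_{j\in S}a_jd_{ij}\Big)\pi_i.\] If for some $\theta\in(0,\frac p2]$, $U+(2\theta-1)V>0$, then for any $s\ge\theta$ we have $\mathbb{E}[\tau_x^s]=\infty$ for all sufficiently large $X_0>x$.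
   Context: Locally finite means $\Sigma\cap([0,r]\times S)$ is finite for every $r\ge0$. Write $\mathbb{E}_{x,i}[\cdot]=\mathbb{E}[\cdot\mid X_n=x,\eta_n=i]$, $q_{ij}(x)=\Pr[\eta_{n+1}=j\mid X_n=x,\eta_n=i]$, $\mu_i(x)=\mathbb{E}_{x,i}[X_{n+1}-X_n]$, $\sigma_i^2(x)=\mathbb{E}_{x,i}[(X_{n+1}-X_n)^2]$, $\mu_{ij}(x)=\mathbb{E}_{x,i}[(X_{n+1}-X_n)\mathbf 1\{\eta_{n+1}=j\}]$, and $\tau_x=\min\{n\ge0:X_n\le x\}$. (Q$_G$): there are $\gamma_{ij}\in\mathbb{R}$ with $q_{ij}(x)=q_{ij}+\gamma_{ij}/x+o(x^{-1})$ as $x\to\infty$, where $(q_{ij})$ is an irreducible stochastic matrix with stationary distribution $\pi$. (D$_G$): there are $d_i,e_i,d_{ij}\in\mathbb{R}$ and $t_i^2\ge0$ with at least one $t_i^2\ne0$, such that as $x\to\infty$: $\mu_i(x)=d_i+e_i/x+o(x^{-1})$, $\sigma_i^2(x)=t_i^2+o(1)$, $\mu_{ij}(x)=d_{ij}+o(1)$ for all $i,j$, and $\sum_i\pi_id_i=0$. (Such $\mathbf a$ exists and is unique up to translation; $U,V$ do not depend on the choice.) *)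

theory Defs
  imports "HOL-Probability.Probability" "HOL-Library.Landau_Symbols"
begin

text \<open>The chain lives on a locally finite (hence countable) set Sigma of states (x,i);
  its time-homogeneous transition law is a kernel K mapping a state to a discrete
  distribution of the next state.\<close>

definition locally_finite_states :: "(real \<times> 's) set \<Rightarrow> bool" where
  "locally_finite_states Sig \<longleftrightarrow> (\<forall>r\<ge>0. finite (Sig \<inter> ({0..r} \<times> UNIV)))"

definition line :: "(real \<times> 's) set \<Rightarrow> 's \<Rightarrow> real set" where
  "line Sig k = {x. (x, k) \<in> Sig}"

definition kernel_on :: "(real \<times> 's) set \<Rightarrow> (real \<times> 's \<Rightarrow> (real \<times> 's) pmf) \<Rightarrow> bool" where
  "kernel_on Sig K \<longleftrightarrow> (\<forall>z\<in>Sig. set_pmf (K z) \<subseteq> Sig)"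

text \<open>Irreducibility of the chain on Sigma: every state is reachable from every state.\<close>
definition irreducible_kernel :: "(real \<times> 's) set \<Rightarrow> (real \<times> 's \<Rightarrow> (real \<times> 's) pmf) \<Rightarrow> bool" where
  "irreducible_kernel Sig K \<longleftrightarrow>
     Sig \<times> Sig \<subseteq> ({(z, w). z \<in> Sig \<and> w \<in> set_pmf (K z)})\<^sup>+"

text \<open>(M, Z) is a realisation of the Markov chain with kernel K started at z0:
  finite-dimensional distributions are the product of the transition probabilities.\<close>
definition markov_chain_from ::
  "'w measure \<Rightarrow> (nat \<Rightarrow> 'w \<Rightarrow> real \<times> 's) \<Rightarrow> (real \<times> 's \<Rightarrow> (real \<times> 's) pmf) \<Rightarrow> real \<times> 's \<Rightarrow> bool" where
  "markov_chain_from M Z K z0 \<longleftrightarrow>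
     prob_space M \<and> (\<forall>n. Z n \<in> measurable M (count_space UNIV)) \<and>
     (\<forall>n h. measure M {\<omega>\<in>space M. \<forall>k\<le>n. Z k \<omega> = h k} =
        (if h 0 = z0 then 1 else 0) * (\<Prod>k<n. pmf (K (h k)) (h (Suc k))))"

text \<open>tau_x^s as an extended nonnegative real (infinite if the chain never enters (-inf, x]).\<close>
definition hitting_time_pow :: "real \<Rightarrow> real \<Rightarrow> (nat \<Rightarrow> 'w \<Rightarrow> real \<times> 's) \<Rightarrow> 'w \<Rightarrow> ennreal" where
  "hitting_time_pow x s Z \<omega> =
     (if \<exists>n. fst (Z n \<omega>) \<le> x then ennreal (real (LEAST n. fst (Z n \<omega>) \<le> x) powr s) else \<infinity>)"

text \<open>One-step quantities q_ij(x), mu_i(x), sigma_i^2(x), mu_ij(x).\<close>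
definition qx :: "(real \<times> 's \<Rightarrow> (real \<times> 's) pmf) \<Rightarrow> 's \<Rightarrow> 's \<Rightarrow> real \<Rightarrow> real" where
  "qx K i j x = measure_pmf.prob (K (x, i)) {w. snd w = j}"

definition mux :: "(real \<times> 's \<Rightarrow> (real \<times> 's) pmf) \<Rightarrow> 's \<Rightarrow> real \<Rightarrow> real" where
  "mux K i x = measure_pmf.expectation (K (x, i)) (\<lambda>w. fst w - x)"

definition sigma2x :: "(real \<times> 's \<Rightarrow> (real \<times> 's) pmf) \<Rightarrow> 's \<Rightarrow> real \<Rightarrow> real" where
  "sigma2x K i x = measure_pmf.expectation (K (x, i)) (\<lambda>w. (fst w - x)^2)"

definition muijx :: "(real \<times> 's \<Rightarrow> (real \<times> 's) pmf) \<Rightarrow> 's \<Rightarrow> 's \<Rightarrow> real \<Rightarrow> real" where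
  "muijx K i j x = measure_pmf.expectation (K (x, i)) (\<lambda>w. (fst w - x) * (if snd w = j then 1 else 0))"

text \<open>Limit x \<rightarrow> \<infinity> along the line Lambda_i.\<close>
definition along :: "(real \<times> 's) set \<Rightarrow> 's \<Rightarrow> real filter" where
  "along Sig i = inf at_top (principal (line Sig i))"

definition irreducible_stochastic :: "('s::finite \<Rightarrow> 's \<Rightarrow> real) \<Rightarrow> bool" where
  "irreducible_stochastic q \<longleftrightarrow> (\<forall>i j. q i j \<ge> 0) \<and> (\<forall>i. (\<Sum>j\<in>UNIV. q i j) = 1) \<and>
     (\<forall>i j. (i, j) \<in> {(i, j). q i j > 0}\<^sup>*)"

definition stationary_dist :: "('s::finite \<Rightarrow> 's \<Rightarrow> real) \<Rightarrow> ('s \<Rightarrow> real) \<Rightarrow> bool" where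
  "stationary_dist q \<pi> \<longleftrightarrow> (\<forall>i. \<pi> i \<ge> 0) \<and> (\<Sum>i\<in>UNIV. \<pi> i) = 1 \<and>
     (\<forall>j. (\<Sum>i\<in>UNIV. \<pi> i * q i j) = \<pi> j)"

end

theory Submission
  imports Defs "HOL-Real_Asymp.Real_Asymp"
begin

text \<open>
  Adding to the height x in state i the correction a i + b i / (1 + x), where b solves a Poisson
  equation for q, produces a process Y for which x E[dY] + (2\<theta> - 1)/2 E[dY^2] has the same
  positive limit along every line, so that Y^(2\<theta>) is a submartingale above some level x.
  On the other hand the walk started at height r needs order r^2 steps to fall to r/2, so the
  \<theta>-th moment of the remaining time to fall below x dominates a multiple of Y^(2\<theta>).
  If the \<theta>-th moment of the hitting time were finite, then the contribution to it of the
  event that the walk has not fallen below x before time n would vanish as n grows, and with it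
  the expectation of Y^(2\<theta>) on that event.
  By the submartingale property this expectation is at least the initial value of Y^(2\<theta>) minus
  its supremum below level x, which is positive when the walk starts high enough.
\<close>

section \<open>Killed chains and survival probabilities\<close>

text \<open>With \<beta> = 2\<theta>, one step changes Y^\<beta> in mean by about \<beta>
  Y^(\<beta>-2) (Y E[dY] + (\<beta>-1)/2 E[dY^2]). After the shift by \<open>a\<close> alone, the
  bracket has on line i a limit w_i of either sign; the hypothesis only makes its \<pi>-average (U +
  (2\<theta>-1) V)/2 positive. The term b_i / (1 + x) adds (q b - b)_i to w_i, and these vectors are
  exactly those of \<pi>-mean 0, so \<open>b\<close> can level all w_i to that average. The jumps
  only have a bounded moment of order p > 2, and one jump may cross any level. The estimates are
  therefore one-sided: powers are bounded below by a quadratic minus a truncated second moment, and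
  the speed of descent is controlled by the squared downward displacement. Drift of order 1/x and
  bounded second moments make its mean grow at most linearly in time while the walk is above r/2,
  hence the scale r^2. The analysis is phrased through iterates of a kernel operator; the
  probability space enters only when survival probabilities are compared with path events.\<close>

definition killed_op :: "('z \<Rightarrow> 'z pmf) \<Rightarrow> 'z set \<Rightarrow> ('z \<Rightarrow> ennreal) \<Rightarrow> 'z \<Rightarrow> ennreal" where
  "killed_op K A g z = indicator A z * (\<integral>\<^sup>+ w. g w \<partial>measure_pmf (K z))"

text \<open>At z this is the probability that the chain from z is in \<open>A\<close> at all of the
  times 0, ..., n, that is, that the exit time exceeds n: the iterates check times 0 to n - 1, the
  initial \<open>indicator A\<close> checks time n.\<close>

definition survival :: "('z \<Rightarrow> 'z pmf) \<Rightarrow> 'z set \<Rightarrow> nat \<Rightarrow> 'z \<Rightarrow> ennreal" where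
  "survival K A n = (killed_op K A ^^ n) (indicator A)"

lemma killed_op_Suc:
  "(killed_op K A ^^ Suc n) g z
    = indicator A z * (\<integral>\<^sup>+ w. (killed_op K A ^^ n) g w \<partial>measure_pmf (K z))"
  by (simp add: killed_op_def)

lemma survival_0: "survival K A 0 z = indicator A z"
  by (simp add: survival_def)

lemma survival_Suc:
  "survival K A (Suc n) z = indicator A z * (\<integral>\<^sup>+ w. survival K A n w \<partial>measure_pmf (K z))"
  by (simp add: survival_def killed_op_def)

lemma killed_op_mono_on:
  assumes closed: "\<And>z. z \<in> S \<Longrightarrow> set_pmf (K z) \<subseteq> S"
    and le: "\<And>z. z \<in> S \<Longrightarrow> g z \<le> h z" and "z \<in> S"
  shows "(killed_op K A ^^ n) g z \<le> (killed_op K A ^^ n) h z"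
  using \<open>z \<in> S\<close>
proof (induction n arbitrary: z)
  case (Suc n)
  then have "AE w in measure_pmf (K z). (killed_op K A ^^ n) g w \<le> (killed_op K A ^^ n) h w"
    using closed by (auto simp: AE_measure_pmf_iff)
  then show ?case
    unfolding killed_op_Suc by (intro mult_left_mono nn_integral_mono_AE) auto
qed (use le in simp)

lemma killed_op_suminf:
  "(killed_op K A ^^ n) (\<lambda>w. \<Sum>m. c m * g m w) z = (\<Sum>m. c m * (killed_op K A ^^ n) (g m) z)"
proof (induction n arbitrary: z)
  case (Suc n)
  have "(killed_op K A ^^ Suc n) (\<lambda>w. \<Sum>m. c m * g m w) z
    = indicator A z * (\<integral>\<^sup>+ w. (\<Sum>m. c m * (killed_op K A ^^ n) (g m) w) \<partial>measure_pmf (K z))"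
    by (simp add: killed_op_Suc Suc del: funpow.simps)
  also have "\<dots> = (\<Sum>m. indicator A z * (c m * (\<integral>\<^sup>+ w. (killed_op K A ^^ n) (g m) w \<partial>measure_pmf (K z))))"
    by (simp add: nn_integral_suminf nn_integral_cmult)
  finally show ?case
    by (simp add: killed_op_Suc mult.left_commute del: funpow.simps)
qed simp

lemma killed_op_cmult:
  "(killed_op K A ^^ n) (\<lambda>w. c * g w) z = c * (killed_op K A ^^ n) g z"
proof (induction n arbitrary: z)
  case (Suc n)
  then have "(killed_op K A ^^ n) (\<lambda>w. c * g w) = (\<lambda>z. c * (killed_op K A ^^ n) g z)" by auto
  then show ?case
    by (simp add: killed_op_Suc nn_integral_cmult mult.left_commute del: funpow.simps)
qed simp

lemma survival_add:
  "(killed_op K A ^^ n) (survival K A m) z = survival K A (n + m) z"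
  by (simp add: survival_def funpow_add)

lemma survival_antimono: "survival K A (Suc n) z \<le> survival K A n z"
proof (induction n arbitrary: z)
  case 0
  have "(\<integral>\<^sup>+ w. indicator A w \<partial>measure_pmf (K z)) \<le> (\<integral>\<^sup>+ w. 1 \<partial>measure_pmf (K z))"
    by (intro nn_integral_mono) (auto simp: indicator_def)
  then show ?case
    by (auto simp: survival_Suc survival_0 indicator_def split: if_splits)
next
  case (Suc n)
  show ?case
    unfolding survival_Suc[of K A "Suc n"] survival_Suc[of K A n]
    using Suc by (intro mult_left_mono nn_integral_mono) (auto simp: survival_Suc)
qed

lemma survival_mono_set:
  assumes "A \<subseteq> B" shows "survival K A n z \<le> survival K B n z"
proof (induction n arbitrary: z)
  case (Suc n)
  then show ?case
    using assms unfolding survival_Suc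
    by (intro mult_mono nn_integral_mono) (auto simp: indicator_def)
qed (use assms in \<open>auto simp: survival_0 indicator_def\<close>)

text \<open>Optional stopping at the exit time from \<open>A\<close>, in kernel form: paths that
  have left by time n contribute at most \<open>B\<close>, the others contribute the killed
  expectation.\<close>

lemma killed_submartingale:
  assumes closed: "\<And>z. z \<in> S \<Longrightarrow> set_pmf (K z) \<subseteq> S"
    and sub: "\<And>z. z \<in> S \<inter> A \<Longrightarrow> f z \<le> (\<integral>\<^sup>+ w. f w \<partial>measure_pmf (K z))"
    and bdd: "\<And>z. z \<in> S - A \<Longrightarrow> f z \<le> B" and "z \<in> S"
  shows "f z \<le> B + (killed_op K A ^^ n) (\<lambda>w. indicator A w * f w) z"
  using \<open>z \<in> S\<close>
proof (induction n arbitrary: z)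
  case 0
  then show ?case using bdd[of z] by (auto simp: indicator_def)
next
  case (Suc n)
  show ?case
  proof (cases "z \<in> A")
    case True
    have "f z \<le> (\<integral>\<^sup>+ w. f w \<partial>measure_pmf (K z))" using sub True Suc by auto
    also have "\<dots> \<le> (\<integral>\<^sup>+ w. B + (killed_op K A ^^ n) (\<lambda>w. indicator A w * f w) w \<partial>measure_pmf (K z))"
      using Suc closed[of z] by (intro nn_integral_mono_AE) (auto simp: AE_measure_pmf_iff)
    also have "\<dots> = B + (killed_op K A ^^ Suc n) (\<lambda>w. indicator A w * f w) z"
      using True by (simp add: nn_integral_add killed_op_Suc del: funpow.simps)
    finally show ?thesis .
  next
    case False
    then show ?thesis using bdd[of z] Suc.prems by (auto intro: order_trans)
  qed
qed

text \<open>If the weighted survival sum were finite, its shifts by n would tend to 0, yet they dominate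
  a multiple of the killed expectation of the submartingale f, which stays above f z0 - B.\<close>
lemma survival_sum_infinite:
  fixes c :: "nat \<Rightarrow> ennreal"
  assumes closed: "\<And>z. z \<in> S \<Longrightarrow> set_pmf (K z) \<subseteq> S"
    and sub: "\<And>z. z \<in> S \<inter> A \<Longrightarrow> f z \<le> (\<integral>\<^sup>+ w. f w \<partial>measure_pmf (K z))"
    and bdd: "\<And>z. z \<in> S - A \<Longrightarrow> f z \<le> B"
    and dom: "\<And>z. z \<in> S \<inter> A \<Longrightarrow> k * f z \<le> (\<Sum>m. c m * survival K A m z)"
    and "0 < k" and z0: "z0 \<in> S" "B < f z0"
    and c_inf: "(\<Sum>m. c m) = \<infinity>"
  shows "(\<Sum>m. c m * survival K A m z0) = \<infinity>"
proof (rule ccontr)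
  let ?s = "\<lambda>n. survival K A n z0"
  assume neq: "(\<Sum>m. c m * ?s m) \<noteq> \<infinity>"
  have anti: "?s (n + m) \<le> ?s m" for n m
    by (induction n) (auto intro: order_trans[OF survival_antimono])
  have dec: "decseq ?s"
    by (intro decseq_SucI survival_antimono)
  \<comment> \<open>\<open>l\<close> is the probability of never leaving \<open>A\<close>. The
    weights have infinite sum, so a finite weighted sum forces \<open>l = 0\<close>.\<close>
  define l where "l = (INF n. ?s n)"
  have lim: "?s \<longlonglongrightarrow> l" unfolding l_def by (rule LIMSEQ_INF[OF dec])
  have "(\<Sum>m. c m * l) \<le> (\<Sum>m. c m * ?s m)"
    by (intro suminf_le mult_left_mono) (auto simp: l_def intro: INF_lower)
  also have "(\<Sum>m. c m * l) = (\<Sum>m. c m) * l"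
    by (simp add: ennreal_suminf_multc)
  finally have "l = 0" using neq c_inf
    by (metis ennreal_top_mult infinity_ennreal_def neq_top_trans top.not_eq_extremum)
  have c_fin: "c m * ?s m \<noteq> \<infinity>" for m
  proof -
    have "c m * ?s m \<le> (\<Sum>m. c m * ?s m)"
      using sum_le_suminf[of "\<lambda>m. c m * ?s m" "{m}"] by simp
    then show ?thesis using neq by (auto simp: top_unique)
  qed
  have lim0: "(\<lambda>n. c m * ?s (n + m)) \<longlonglongrightarrow> 0" for m
  proof (cases "c m = \<infinity>")
    \<comment> \<open>A weight may be infinite; finiteness of the series then makes survival vanish
      from time m on.\<close>
    case True
    then have "?s m = 0" using c_fin[of m] by (auto simp: ennreal_mult_eq_top_iff)
    then have "?s (n + m) = 0" for n using anti[of n m] by simp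
    then show ?thesis by simp
  next
    case False
    have "(\<lambda>n. ?s (n + m)) \<longlonglongrightarrow> 0"
      using lim \<open>l = 0\<close> by (intro LIMSEQ_ignore_initial_segment) simp
    then have "(\<lambda>n. c m * ?s (n + m)) \<longlonglongrightarrow> c m * 0"
      using False by (intro tendsto_mult_ennreal) auto
    then show ?thesis by simp
  qed
  \<comment> \<open>Dominated convergence for the counting measure, with the unshifted terms as
    summable majorant.\<close>
  have "(\<lambda>n. \<integral>\<^sup>+ m. c m * ?s (n + m) \<partial>count_space UNIV) \<longlonglongrightarrow> (\<integral>\<^sup>+ m. 0 \<partial>count_space (UNIV :: nat set))"
  proof (rule nn_integral_dominated_convergence)
    show "AE m in count_space UNIV. c m * ?s (n + m) \<le> c m * ?s m" for n
      using anti by (intro AE_I2 mult_left_mono) auto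
    show "(\<integral>\<^sup>+ m. c m * ?s m \<partial>count_space UNIV) < \<infinity>"
      using neq by (simp add: nn_integral_count_space_nat top.not_eq_extremum)
  qed (use lim0 in auto)
  then have tails: "(\<lambda>n. \<Sum>m. c m * ?s (n + m)) \<longlonglongrightarrow> 0"
    by (simp add: nn_integral_count_space_nat)
  have "k * (f z0 - B) \<le> (\<Sum>m. c m * ?s (n + m))" for n
  proof -
    have "k * (f z0 - B) \<le> k * (killed_op K A ^^ n) (\<lambda>w. indicator A w * f w) z0"
      using killed_submartingale[of S K A f B z0 n, OF closed sub bdd z0(1)]
      using z0(2) by (intro mult_left_mono) (auto simp: ennreal_minus_le_iff)
    also have "\<dots> = (killed_op K A ^^ n) (\<lambda>w. k * (indicator A w * f w)) z0"
      by (simp add: killed_op_cmult)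
    also have "\<dots> \<le> (killed_op K A ^^ n) (\<lambda>w. \<Sum>m. c m * survival K A m w) z0"
      using dom by (intro killed_op_mono_on[where S = S, OF closed _ z0(1)]) (auto simp: indicator_def)
    also have "\<dots> = (\<Sum>m. c m * ?s (n + m))"
      by (simp add: killed_op_suminf survival_add)
    finally show ?thesis .
  qed
  then have "k * (f z0 - B) \<le> 0"
    using tails by (intro LIMSEQ_le_const) auto
  then show False
    using \<open>0 < k\<close> z0 by (auto simp: ennreal_minus_eq_0 diff_eq_0_iff_ennreal)
qed

text \<open>The minorants used below (a linear survival bound, a Taylor polynomial) may be negative,
  so \<open>g\<close> is cut off at 0 before it is compared with a nonnegative integral.\<close>

lemma nn_integral_ge_expectation:
  assumes "integrable (measure_pmf P) g" and "\<And>w. w \<in> set_pmf P \<Longrightarrow> ennreal (g w) \<le> f w"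
  shows "ennreal (measure_pmf.expectation P g) \<le> (\<integral>\<^sup>+ w. f w \<partial>measure_pmf P)"
proof -
  have "measure_pmf.expectation P g \<le> measure_pmf.expectation P (\<lambda>w. max 0 (g w))"
    using assms by (intro integral_mono) auto
  then have "ennreal (measure_pmf.expectation P g) \<le> ennreal (measure_pmf.expectation P (\<lambda>w. max 0 (g w)))"
    by (rule ennreal_leI)
  also have "\<dots> = (\<integral>\<^sup>+ w. ennreal (max 0 (g w)) \<partial>measure_pmf P)"
    using assms by (intro nn_integral_eq_integral[symmetric]) auto
  also have "\<dots> \<le> (\<integral>\<^sup>+ w. f w \<partial>measure_pmf P)"
    using assms by (intro nn_integral_mono_AE) (auto simp: AE_measure_pmf_iff max_def)
  finally show ?thesis .
qed

text \<open>A bounded-drift argument: \<phi> grows by at most C per step in mean and must reach D on exit.\<close>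
lemma survival_ge:
  fixes \<phi> :: "'z \<Rightarrow> real"
  assumes closed: "\<And>z. z \<in> S \<Longrightarrow> set_pmf (K z) \<subseteq> S"
    and "D > 0" "C \<ge> 0" and nonneg: "\<And>z. z \<in> S \<Longrightarrow> 0 \<le> \<phi> z"
    and out: "\<And>z. z \<in> S - A \<Longrightarrow> D \<le> \<phi> z"
    and int: "\<And>z. z \<in> S \<inter> A \<Longrightarrow> integrable (measure_pmf (K z)) \<phi>"
    and drift: "\<And>z. z \<in> S \<inter> A \<Longrightarrow> measure_pmf.expectation (K z) \<phi> \<le> \<phi> z + C"
    and "z \<in> S"
  shows "ennreal (1 - (\<phi> z + C * real n) / D) \<le> survival K A n z"
  using \<open>z \<in> S\<close>
proof (induction n arbitrary: z)
  case 0
  show ?case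
  proof (cases "z \<in> A")
    case True
    then show ?thesis using 0 nonneg[of z] \<open>D > 0\<close> by (auto simp: survival_0)
  next
    case False
    \<comment> \<open>Outside \<open>A\<close> the claimed lower bound is not positive, so
      \<open>ennreal\<close> turns it into 0.\<close>
    then have "1 \<le> \<phi> z / D" using out[of z] 0 \<open>D > 0\<close> by auto
    then show ?thesis using False by (auto simp: survival_0 ennreal_eq_0_iff)
  qed
next
  case (Suc n)
  show ?case
  proof (cases "z \<in> A")
    case True
    have "ennreal (1 - (\<phi> z + C * real (Suc n)) / D)
      \<le> ennreal (1 - (measure_pmf.expectation (K z) \<phi> + C * real n) / D)"
      using drift[of z] True Suc.prems \<open>D > 0\<close>
      by (intro ennreal_leI diff_left_mono divide_right_mono) (auto simp: algebra_simps)
    also have "\<dots> = ennreal (measure_pmf.expectation (K z) (\<lambda>w. 1 - (\<phi> w + C * real n) / D))"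
      using int[of z] True Suc.prems by (simp add: add_divide_distrib)
    also have "\<dots> \<le> (\<integral>\<^sup>+ w. survival K A n w \<partial>measure_pmf (K z))"
      using int[of z] True Suc closed[of z] by (intro nn_integral_ge_expectation) auto
    finally show ?thesis using True by (simp add: survival_Suc)
  next
    case False
    then have "1 \<le> \<phi> z / D" using out[of z] Suc \<open>D > 0\<close> by auto
    moreover have "(\<phi> z + C * real (Suc n)) / D \<ge> \<phi> z / D"
      using \<open>C \<ge> 0\<close> \<open>D > 0\<close> by (intro divide_right_mono) auto
    ultimately have "1 - (\<phi> z + C * real (Suc n)) / D \<le> 0" by linarith
    then show ?thesis using False by (auto simp: survival_Suc ennreal_eq_0_iff)
  qed
qed

section \<open>From the kernel to path events and moments of hitting times\<close>

lemma markov_chain_fromD: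
  assumes "markov_chain_from M Z K z0"
  shows "prob_space M" "Z n \<in> measurable M (count_space UNIV)"
    "measure M {\<omega>\<in>space M. \<forall>k\<le>n. Z k \<omega> = h k}
      = (if h 0 = z0 then 1 else 0) * (\<Prod>k<n. pmf (K (h k)) (h (Suc k)))"
  using assms unfolding markov_chain_from_def by blast+

lemma sets_Collect_chain:
  fixes Z :: "nat \<Rightarrow> 'w \<Rightarrow> 'z"
  assumes "\<And>k. Z k \<in> measurable M (count_space UNIV)"
  shows "{\<omega>\<in>space M. \<forall>k\<le>n. Z k \<omega> = h k} \<in> sets M"
    "{\<omega>\<in>space M. \<forall>k\<le>n. Z k \<omega> \<in> A} \<in> sets M"
    "{\<omega>\<in>space M. (\<forall>k\<le>i. Z k \<omega> = h k) \<and> (\<forall>k\<in>{i..i+l}. Z k \<omega> \<in> A)} \<in> sets M"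
proof -
  have *: "{\<omega>\<in>space M. Z k \<omega> \<in> B} \<in> sets M" for k B
    using measurable_sets[OF assms, of B k] by (simp add: vimage_def Int_def conj_commute)
  have **: "{\<omega>\<in>space M. \<forall>k\<in>I. Z k \<omega> \<in> B k} \<in> sets M" if "finite I" for I B
    by (rule sets.sets_Collect_finite_All[OF * that])
  show 1: "{\<omega>\<in>space M. \<forall>k\<le>n. Z k \<omega> = h k} \<in> sets M" for n
    using **[OF finite_atMost, of n "\<lambda>k. {h k}"] by (simp only: Ball_def atMost_iff singleton_iff)
  show "{\<omega>\<in>space M. \<forall>k\<le>n. Z k \<omega> \<in> A} \<in> sets M"
    using **[OF finite_atMost, of n "\<lambda>k. A"] by (simp only: Ball_def atMost_iff)
  show "{\<omega>\<in>space M. (\<forall>k\<le>i. Z k \<omega> = h k) \<and> (\<forall>k\<in>{i..i+l}. Z k \<omega> \<in> A)} \<in> sets M"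
    by (intro sets.sets_Collect_conj 1 **[of "{i..i+l}" "\<lambda>_. A", OF finite_atLeastAtMost])
qed

text \<open>Only the probabilities of finite paths are given, so the Markov property is recovered by
  induction on n for all prefixes \<open>h\<close> at once: the next state w extends the prefix, and
  the events for different w are disjoint.\<close>

lemma markov_chain_stays:
  assumes mc: "markov_chain_from M Z K z0"
  shows "emeasure M {\<omega>\<in>space M. \<forall>k\<le>j. Z k \<omega> = h k} * survival K A n (h j)
    \<le> emeasure M {\<omega>\<in>space M. (\<forall>k\<le>j. Z k \<omega> = h k) \<and> (\<forall>k\<in>{j..j+n}. Z k \<omega> \<in> A)}"
proof (induction n arbitrary: j h)
  case 0
  show ?case
  proof (cases "h j \<in> A")
    case True
    then have "{\<omega>\<in>space M. (\<forall>k\<le>j. Z k \<omega> = h k) \<and> (\<forall>k\<in>{j..j+0}. Z k \<omega> \<in> A)}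
      = {\<omega>\<in>space M. \<forall>k\<le>j. Z k \<omega> = h k}" by auto
    then show ?thesis using True by (simp add: survival_0)
  qed (simp add: survival_0)
next
  case (Suc n)
  have Z: "Z k \<in> measurable M (count_space UNIV)" for k
    by (rule markov_chain_fromD(2)[OF mc])
  interpret prob_space M by (rule markov_chain_fromD(1)[OF mc])
  show ?case
  proof (cases "h j \<in> A")
    case True
    let ?W = "set_pmf (K (h j))"
    define P where "P i g = emeasure M {\<omega>\<in>space M. \<forall>k\<le>i. Z k \<omega> = g k}" for i g
    define E where "E w = {\<omega>\<in>space M. (\<forall>k\<le>Suc j. Z k \<omega> = (h(Suc j := w)) k)
      \<and> (\<forall>k\<in>{Suc j..Suc j + n}. Z k \<omega> \<in> A)}" for w
    have stay_sets: "{\<omega>\<in>space M. (\<forall>k\<le>i. Z k \<omega> = g k) \<and> (\<forall>k\<in>{i..i+l}. Z k \<omega> \<in> A)} \<in> sets M"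
      for i l g by (rule sets_Collect_chain(3)[OF Z])
    have E_sets: "E w \<in> sets M" for w unfolding E_def by (rule stay_sets)
    have step: "P (Suc j) (h(Suc j := w)) = P j h * ennreal (pmf (K (h j)) w)" for w
    proof -
      have "measure M {\<omega>\<in>space M. \<forall>k\<le>Suc j. Z k \<omega> = (h(Suc j := w)) k}
        = measure M {\<omega>\<in>space M. \<forall>k\<le>j. Z k \<omega> = h k} * pmf (K (h j)) w"
      proof -
        have "(\<Prod>k<j. pmf (K ((h(Suc j := w)) k)) ((h(Suc j := w)) (Suc k)))
          = (\<Prod>k<j. pmf (K (h k)) (h (Suc k)))"
          by (intro prod.cong) auto
        then show ?thesis unfolding markov_chain_fromD(3)[OF mc] by simp
      qed
      then show ?thesis unfolding P_def emeasure_eq_measure by (simp only: ennreal_mult measure_nonneg pmf_nonneg)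
    qed
    have "P j h * survival K A (Suc n) (h j) = (\<integral>\<^sup>+ w. P j h * survival K A n w \<partial>measure_pmf (K (h j)))"
      using True by (simp add: survival_Suc nn_integral_cmult)
    also have "\<dots> = (\<integral>\<^sup>+ w. P (Suc j) (h(Suc j := w)) * survival K A n w \<partial>count_space UNIV)"
      by (simp add: nn_integral_measure_pmf step mult_ac)
    \<comment> \<open>Off the support of the transition law the path probabilities vanish. This
      reduces the sum to a countable set, as additivity of the measure requires.\<close>
    also have "\<dots> = (\<integral>\<^sup>+ w. P (Suc j) (h(Suc j := w)) * survival K A n w \<partial>count_space ?W)"
      by (intro nn_integral_count_space_eq) (auto simp: step set_pmf_iff)
    also have "\<dots> \<le> (\<integral>\<^sup>+ w. emeasure M (E w) \<partial>count_space ?W)"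
    proof (rule nn_integral_mono)
      fix w
      show "P (Suc j) (h(Suc j := w)) * survival K A n w \<le> emeasure M (E w)"
        using Suc.IH[of "Suc j" "h(Suc j := w)"] unfolding E_def P_def fun_upd_same .
    qed
    also have "\<dots> = emeasure M (\<Union>w\<in>?W. E w)"
    proof (rule emeasure_UN_countable[symmetric])
      show "disjoint_family_on E ?W"
        by (auto simp: disjoint_family_on_def E_def)
    qed (use E_sets in auto)
    also have "\<dots> \<le> emeasure M {\<omega>\<in>space M. (\<forall>k\<le>j. Z k \<omega> = h k) \<and> (\<forall>k\<in>{j..j + Suc n}. Z k \<omega> \<in> A)}"
    proof (rule emeasure_mono)
      show "(\<Union>w\<in>?W. E w) \<subseteq> {\<omega>\<in>space M. (\<forall>k\<le>j. Z k \<omega> = h k) \<and> (\<forall>k\<in>{j..j + Suc n}. Z k \<omega> \<in> A)}"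
      proof safe
        fix w \<omega> assume "\<omega> \<in> E w"
        then have *: "\<omega> \<in> space M" "\<And>k. k \<le> Suc j \<Longrightarrow> Z k \<omega> = (h(Suc j := w)) k"
          "\<And>k. k \<in> {Suc j..Suc j + n} \<Longrightarrow> Z k \<omega> \<in> A" by (auto simp: E_def)
        show "\<omega> \<in> space M" by fact
        show hk: "Z k \<omega> = h k" if "k \<le> j" for k using *(2)[of k] that by auto
        show "Z k \<omega> \<in> A" if "k \<in> {j..j + Suc n}" for k
        proof (cases "k = j")
          case False
          then show ?thesis using *(3)[of k] that by auto
        qed (use hk True in auto)
      qed
    qed (rule stay_sets)
    finally show ?thesis unfolding P_def .
  qed (simp add: survival_Suc)
qed

lemma survival_le_prob:
  assumes mc: "markov_chain_from M Z K z0"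
  shows "survival K A n z0 \<le> emeasure M {\<omega>\<in>space M. \<forall>k\<le>n. Z k \<omega> \<in> A}"
proof -
  interpret prob_space M by (rule markov_chain_fromD(1)[OF mc])
  have Z: "Z k \<in> measurable M (count_space UNIV)" for k
    by (rule markov_chain_fromD(2)[OF mc])
  have "measure M {\<omega>\<in>space M. \<forall>k\<le>0. Z k \<omega> = z0} = 1"
    using markov_chain_fromD(3)[OF mc, of 0 "\<lambda>_. z0"] by simp
  then have "survival K A n z0 \<le> emeasure M {\<omega>\<in>space M. (\<forall>k\<le>0. Z k \<omega> = z0) \<and> (\<forall>k\<in>{0..0+n}. Z k \<omega> \<in> A)}"
    using markov_chain_stays[OF mc, of 0 "\<lambda>_. z0" A n] by (simp add: emeasure_eq_measure)
  also have "\<dots> \<le> emeasure M {\<omega>\<in>space M. \<forall>k\<le>n. Z k \<omega> \<in> A}"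
    by (intro emeasure_mono sets_Collect_chain(2) Z) auto
  finally show ?thesis .
qed

text \<open>The weights of summation by parts: E[T^\<theta>] is the sum over m of weight times P(T >
  m). As \<open>0 powr \<theta> = 0\<close>, the weight at m = 0 is 1.\<close>

definition powr_incr :: "real \<Rightarrow> nat \<Rightarrow> ennreal" where
  "powr_incr \<theta> m = ennreal (real (Suc m) powr \<theta> - real m powr \<theta>)"

lemma sum_powr_incr:
  assumes "\<theta> > 0" shows "(\<Sum>m<n. powr_incr \<theta> m) = ennreal (real n powr \<theta>)"
proof -
  have "(\<Sum>m<n. powr_incr \<theta> m) = ennreal (\<Sum>m<n. real (Suc m) powr \<theta> - real m powr \<theta>)"
    unfolding powr_incr_def using assms by (intro sum_ennreal) (auto intro!: powr_mono2)
  then show ?thesis using sum_lessThan_telescope[of "\<lambda>m. real m powr \<theta>" n] assms by simp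
qed

lemma suminf_powr_incr:
  assumes "\<theta> > 0" shows "(\<Sum>m. powr_incr \<theta> m) = \<infinity>"
proof (rule ccontr)
  assume "(\<Sum>m. powr_incr \<theta> m) \<noteq> \<infinity>"
  then obtain r where r: "(\<Sum>m. powr_incr \<theta> m) = ennreal r" "r \<ge> 0"
    by (cases "\<Sum>m. powr_incr \<theta> m") auto
  have "real n powr \<theta> \<le> r" for n
    using sum_le_suminf[of "powr_incr \<theta>" "{..<n}"] r assms by (simp add: sum_powr_incr)
  moreover have "filterlim (\<lambda>n. real n powr \<theta>) at_top at_top"
    using assms by real_asymp
  then have "eventually (\<lambda>n. real n powr \<theta> > r) at_top"
    by (simp add: filterlim_at_top_dense)
  ultimately show False by (auto simp: eventually_at_top_linorder not_less[symmetric])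
qed

text \<open>The left side is the \<theta>-th power of the hitting time of the higher level x', which
  comes no later than that of x; an integer time t also satisfies t^\<theta> \<le> t^s. Hence one
  exponent and one conveniently high level suffice.\<close>

lemma hitting_time_pow_ge:
  assumes "0 < \<theta>" "\<theta> \<le> s" "x \<le> x'"
  shows "(\<Sum>m. powr_incr \<theta> m * indicator {\<omega>. \<forall>k\<le>m. x' < fst (Z k \<omega>)} \<omega>) \<le> hitting_time_pow x s Z \<omega>"
proof (cases "\<exists>n. fst (Z n \<omega>) \<le> x")
  case True
  define t where "t = (LEAST n. fst (Z n \<omega>) \<le> x)"
  have t: "fst (Z t \<omega>) \<le> x" unfolding t_def using True by (rule LeastI_ex)
  have "(\<Sum>m. powr_incr \<theta> m * indicator {\<omega>. \<forall>k\<le>m. x' < fst (Z k \<omega>)} \<omega>)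
    = (\<Sum>m<t. powr_incr \<theta> m * indicator {\<omega>. \<forall>k\<le>m. x' < fst (Z k \<omega>)} \<omega>)"
    using t \<open>x \<le> x'\<close> by (intro suminf_finite) (auto simp: indicator_def not_less intro!: exI[of _ t])
  also have "\<dots> \<le> (\<Sum>m<t. powr_incr \<theta> m)"
    by (intro sum_mono) (auto simp: indicator_def)
  also have "\<dots> = ennreal (real t powr \<theta>)" using assms by (simp add: sum_powr_incr)
  also have "\<dots> \<le> ennreal (real t powr s)"
    using assms by (cases "t = 0") (auto intro!: ennreal_leI powr_mono)
  finally show ?thesis using True by (simp add: hitting_time_pow_def t_def)
qed (simp add: hitting_time_pow_def)

lemma hitting_time_infinite:
  assumes mc: "markov_chain_from M Z K z0"
    and "0 < \<theta>" "\<theta> \<le> s" "x \<le> x'"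
    and inf: "(\<Sum>m. powr_incr \<theta> m * survival K {z. x' < fst z} m z0) = \<infinity>"
  shows "(\<integral>\<^sup>+ \<omega>. hitting_time_pow x s Z \<omega> \<partial>M) = \<infinity>"
proof -
  define J where "J m = {\<omega>\<in>space M. \<forall>k\<le>m. Z k \<omega> \<in> {z. x' < fst z}}" for m
  have J_sets: "J m \<in> sets M" for m
    unfolding J_def by (rule sets_Collect_chain(2)[OF markov_chain_fromD(2)[OF mc]])
  have "(\<Sum>m. powr_incr \<theta> m * survival K {z. x' < fst z} m z0) \<le> (\<Sum>m. powr_incr \<theta> m * emeasure M (J m))"
    unfolding J_def by (intro suminf_le mult_left_mono survival_le_prob[OF mc]) auto
  also have "\<dots> = (\<Sum>m. \<integral>\<^sup>+ \<omega>. powr_incr \<theta> m * indicator (J m) \<omega> \<partial>M)"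
    using J_sets by (simp add: nn_integral_cmult_indicator)
  also have "\<dots> = (\<integral>\<^sup>+ \<omega>. (\<Sum>m. powr_incr \<theta> m * indicator (J m) \<omega>) \<partial>M)"
    using J_sets by (intro nn_integral_suminf[symmetric]) simp
  also have "\<dots> = (\<integral>\<^sup>+ \<omega>. (\<Sum>m. powr_incr \<theta> m * indicator {\<omega>. \<forall>k\<le>m. x' < fst (Z k \<omega>)} \<omega>) \<partial>M)"
  proof (rule nn_integral_cong)
    fix \<omega> assume "\<omega> \<in> space M"
    then have "indicator (J m) \<omega> = (indicator {\<omega>. \<forall>k\<le>m. x' < fst (Z k \<omega>)} \<omega> :: ennreal)" for m
      by (simp add: J_def indicator_def)
    then show "(\<Sum>m. powr_incr \<theta> m * indicator (J m) \<omega>)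
      = (\<Sum>m. powr_incr \<theta> m * indicator {\<omega>. \<forall>k\<le>m. x' < fst (Z k \<omega>)} \<omega>)"
      by (simp only:)
  qed
  \<comment> \<open>Monotonicity of the nonnegative integral holds for arbitrary integrands, so
    measurability is established for the events \<open>J m\<close> only.\<close>
  also have "\<dots> \<le> (\<integral>\<^sup>+ \<omega>. hitting_time_pow x s Z \<omega> \<partial>M)"
    using assms by (intro nn_integral_mono hitting_time_pow_ge)
  finally show ?thesis using inf by (simp add: top_unique)
qed

section \<open>Corrected heights\<close>

text \<open>Near 0 this is the second-order expansion with slack \<open>\<epsilon>\<close>. Away
  from 0 no growth of the power is exploited: \<open>C\<close> makes the left side nonpositive, so
  the cost is a truncated second moment and not a moment of order \<beta>.\<close>

lemma powr_taylor_lower: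
  fixes \<beta> \<epsilon> :: real
  assumes "\<beta> > 0" "\<epsilon> > 0"
  obtains C \<rho> where "C \<ge> 0" "\<rho> > 0"
    "\<And>t. 1 + \<beta> * t + (\<beta> * (\<beta> - 1) / 2 - \<epsilon>) * t\<^sup>2 - C * (t\<^sup>2 * indicator {\<rho><..} \<bar>t\<bar>) \<le> max 0 (1 + t) powr \<beta>"
proof -
  let ?c = "\<beta> * (\<beta> - 1) / 2"
  have "((\<lambda>t. ((1 + t) powr \<beta> - 1 - \<beta> * t - ?c * t\<^sup>2) / t\<^sup>2) \<longlongrightarrow> 0) (at 0)"
    using assms by real_asymp
  then have "eventually (\<lambda>t. ((1 + t) powr \<beta> - 1 - \<beta> * t - ?c * t\<^sup>2) / t\<^sup>2 > -\<epsilon>) (at 0)"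
    using assms by (auto dest!: order_tendstoD(1)[where a = "-\<epsilon>"])
  then obtain r where r: "r > 0"
    "\<And>t. t \<noteq> 0 \<Longrightarrow> \<bar>t\<bar> < r \<Longrightarrow> ((1 + t) powr \<beta> - 1 - \<beta> * t - ?c * t\<^sup>2) / t\<^sup>2 > -\<epsilon>"
    by (auto simp: eventually_at dist_real_def)
  \<comment> \<open>\<open>\<rho> < r\<close> keeps |t| \<le> \<rho> inside the range of the
    expansion; \<open>\<rho> < 1\<close> makes 1 + t positive there, so that the maximum with 0 is
    harmless.\<close>
  define \<rho> where "\<rho> = min (r / 2) (1 / 2)"
  have \<rho>: "\<rho> > 0" "\<rho> < r" "\<rho> < 1" using r(1) by (auto simp: \<rho>_def)
  \<comment> \<open>For |t| > \<rho> the three summands, times t^2, dominate 1, \<beta> t and the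
    quadratic term, in this order.\<close>
  define C where "C = 1 / \<rho>\<^sup>2 + \<beta> / \<rho> + \<bar>?c - \<epsilon>\<bar>"
  show thesis
  proof
    show "C \<ge> 0" using \<rho> assms by (auto simp: C_def)
    show "\<rho> > 0" by fact
    fix t :: real
    show "1 + \<beta> * t + (?c - \<epsilon>) * t\<^sup>2 - C * (t\<^sup>2 * indicator {\<rho><..} \<bar>t\<bar>) \<le> max 0 (1 + t) powr \<beta>"
    proof (cases "\<bar>t\<bar> \<le> \<rho>")
      case True
      show ?thesis
      proof (cases "t = 0")
        case False
        then have "(1 + t) powr \<beta> - 1 - \<beta> * t - ?c * t\<^sup>2 > -\<epsilon> * t\<^sup>2"
          using r(2)[of t] True \<rho> by (simp add: less_divide_eq)
        then show ?thesis using True \<rho> by (auto simp: algebra_simps max_def)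
      qed auto
    next
      case False
      have 1: "1 \<le> t\<^sup>2 / \<rho>\<^sup>2"
        using False \<rho> by (simp add: le_divide_eq abs_le_square_iff[symmetric])
      have "\<bar>t\<bar> * \<rho> \<le> \<bar>t\<bar> * \<bar>t\<bar>" using False by (intro mult_left_mono) auto
      then have "\<bar>t\<bar> \<le> t\<^sup>2 / \<rho>" using \<rho> by (simp add: le_divide_eq power2_eq_square)
      then have "\<beta> * \<bar>t\<bar> \<le> \<beta> * (t\<^sup>2 / \<rho>)" using assms by (intro mult_left_mono) auto
      moreover have "\<beta> * t \<le> \<beta> * \<bar>t\<bar>" using assms by (intro mult_left_mono) auto
      moreover have "(?c - \<epsilon>) * t\<^sup>2 \<le> \<bar>?c - \<epsilon>\<bar> * t\<^sup>2" by (intro mult_right_mono) auto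
      moreover have "C * t\<^sup>2 = t\<^sup>2 / \<rho>\<^sup>2 + \<beta> * (t\<^sup>2 / \<rho>) + \<bar>?c - \<epsilon>\<bar> * t\<^sup>2"
        by (simp add: C_def algebra_simps)
      ultimately have "1 + \<beta> * t + (?c - \<epsilon>) * t\<^sup>2 - C * t\<^sup>2 \<le> 0" using 1 by linarith
      also have "0 \<le> max 0 (1 + t) powr \<beta>" by simp
      finally show ?thesis using False by (simp only: indicator_def greaterThan_iff not_le if_True of_bool_eq mult_1_right)
    qed
  qed
qed

text \<open>The Taylor bound at t = (Y - y) / y, scaled by y^\<beta>; \<open>drift\<close> is the
  condition that results after multiplication by y^2.\<close>

lemma powr_submartingale_step:
  fixes Y :: "'z \<Rightarrow> real"
  assumes taylor: "\<And>t. 1 + \<beta> * t + c * t\<^sup>2 - C * (t\<^sup>2 * indicator {\<rho><..} \<bar>t\<bar>) \<le> max 0 (1 + t) powr \<beta>"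
    and "y > 0"
    and int: "integrable (measure_pmf P) (\<lambda>w. Y w - y)" "integrable (measure_pmf P) (\<lambda>w. (Y w - y)\<^sup>2)"
    and drift: "0 \<le> \<beta> * y * measure_pmf.expectation P (\<lambda>w. Y w - y)
       + c * measure_pmf.expectation P (\<lambda>w. (Y w - y)\<^sup>2)
       - C * measure_pmf.expectation P (\<lambda>w. (Y w - y)\<^sup>2 * indicator {\<rho> * y<..} \<bar>Y w - y\<bar>)"
  shows "ennreal (max 0 y powr \<beta>) \<le> (\<integral>\<^sup>+ w. ennreal (max 0 (Y w) powr \<beta>) \<partial>measure_pmf P)"
proof -
  let ?D = "\<lambda>w. Y w - y"
  let ?I = "\<lambda>w. (?D w)\<^sup>2 * indicator {\<rho> * y<..} \<bar>?D w\<bar>"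
  define g where "g w = y powr \<beta> + y powr \<beta> / y\<^sup>2 * (\<beta> * y * ?D w + c * (?D w)\<^sup>2 - C * ?I w)" for w
  have intI: "integrable (measure_pmf P) ?I"
    by (rule Bochner_Integration.integrable_bound[OF int(2)]) (auto simp: indicator_def)
  have "integrable (measure_pmf P) g"
    unfolding g_def using int intI by auto
  moreover have "g w \<le> max 0 (Y w) powr \<beta>" for w
  proof -
    have ind: "indicator {\<rho><..} \<bar>?D w / y\<bar> = (indicator {\<rho> * y<..} \<bar>?D w\<bar> :: real)"
      using \<open>y > 0\<close> by (auto simp: indicator_def field_simps)
    have "g w = y powr \<beta> * (1 + \<beta> * (?D w / y) + c * (?D w / y)\<^sup>2 - C * ((?D w / y)\<^sup>2 * indicator {\<rho><..} \<bar>?D w / y\<bar>))"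
      unfolding ind g_def using \<open>y > 0\<close> by (simp add: field_simps power2_eq_square)
    also have "\<dots> \<le> y powr \<beta> * max 0 (1 + ?D w / y) powr \<beta>"
      by (intro mult_left_mono taylor) auto
    also have "\<dots> = max 0 (Y w) powr \<beta>"
    proof -
      have "y * max 0 (1 + ?D w / y) = max 0 (Y w)"
        using \<open>y > 0\<close> by (auto simp: max_def field_simps)
      then show ?thesis using \<open>y > 0\<close> by (simp add: powr_mult[symmetric])
    qed
    finally show ?thesis .
  qed
  ultimately have "ennreal (measure_pmf.expectation P g) \<le> (\<integral>\<^sup>+ w. ennreal (max 0 (Y w) powr \<beta>) \<partial>measure_pmf P)"
    by (intro nn_integral_ge_expectation ennreal_leI)
  moreover
  have Eg: "measure_pmf.expectation P g = y powr \<beta> + y powr \<beta> / y\<^sup>2 *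
     (\<beta> * y * measure_pmf.expectation P ?D + c * measure_pmf.expectation P (\<lambda>w. (?D w)\<^sup>2) - C * measure_pmf.expectation P ?I)"
    unfolding g_def using int intI by simp
  have "y powr \<beta> \<le> measure_pmf.expectation P g"
    unfolding Eg using mult_nonneg_nonneg[OF _ drift, of "y powr \<beta> / y\<^sup>2"] by simp
  then have "ennreal (max 0 y powr \<beta>) \<le> ennreal (measure_pmf.expectation P g)"
    using \<open>y > 0\<close> by (simp add: max_def ennreal_leI)
  ultimately show ?thesis by (meson order_trans)
qed

text \<open>I - q is singular, but adding the rank-one matrix 1 \<pi> gives an invertible
  \<open>L\<close> with \<pi> L = \<pi>. Applying \<pi> to L b = w identifies the added term with
  the \<pi>-average of w.\<close>

lemma poisson_equation:
  fixes q :: "'s::finite \<Rightarrow> 's \<Rightarrow> real"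
  assumes q: "irreducible_stochastic q" and \<pi>: "stationary_dist q \<pi>"
  obtains b where "\<And>i. w i + (\<Sum>j\<in>UNIV. q i j * b j) - b i = (\<Sum>i\<in>UNIV. \<pi> i * w i)"
proof -
  have q_nonneg: "q i j \<ge> 0" and q_sum: "(\<Sum>j\<in>UNIV. q i j) = 1"
    and q_irr: "(i, j) \<in> {(i, j). q i j > 0}\<^sup>*" for i j
    using q by (auto simp: irreducible_stochastic_def)
  have \<pi>_sum: "(\<Sum>i\<in>UNIV. \<pi> i) = 1" and \<pi>_inv: "(\<Sum>i\<in>UNIV. \<pi> i * q i j) = \<pi> j" for j
    using \<pi> by (auto simp: stationary_dist_def)
  have \<pi>_Q: "(\<Sum>i\<in>UNIV. \<pi> i * (\<Sum>j\<in>UNIV. q i j * b j)) = (\<Sum>j\<in>UNIV. \<pi> j * b j)" for b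
  proof -
    have "(\<Sum>i\<in>UNIV. \<pi> i * (\<Sum>j\<in>UNIV. q i j * b j)) = (\<Sum>i\<in>UNIV. \<Sum>j\<in>UNIV. \<pi> i * q i j * b j)"
      by (simp add: sum_distrib_left mult.assoc)
    also have "\<dots> = (\<Sum>j\<in>UNIV. (\<Sum>i\<in>UNIV. \<pi> i * q i j) * b j)"
      by (subst sum.swap) (simp add: sum_distrib_right)
    finally show ?thesis by (simp add: \<pi>_inv)
  qed
  define L :: "real^'s \<Rightarrow> real^'s" where
    "L b = (\<chi> i. b $ i - (\<Sum>j\<in>UNIV. q i j * b $ j) + (\<Sum>k\<in>UNIV. \<pi> k * b $ k))" for b
  have \<pi>_L: "(\<Sum>i\<in>UNIV. \<pi> i * L b $ i) = (\<Sum>k\<in>UNIV. \<pi> k * b $ k)" for b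
  proof -
    have "(\<Sum>i\<in>UNIV. \<pi> i * L b $ i) = (\<Sum>i\<in>UNIV. \<pi> i * b $ i)
      - (\<Sum>i\<in>UNIV. \<pi> i * (\<Sum>j\<in>UNIV. q i j * b $ j)) + (\<Sum>i\<in>UNIV. \<pi> i) * (\<Sum>k\<in>UNIV. \<pi> k * b $ k)"
      by (simp add: L_def distrib_left right_diff_distrib sum.distrib sum_subtractf sum_distrib_right)
    then show ?thesis by (simp add: \<pi>_Q \<pi>_sum)
  qed
  have "linear L"
    by (rule linearI)
      (simp_all add: L_def vec_eq_iff distrib_left sum.distrib sum_distrib_left right_diff_distrib mult.left_commute)
  moreover have "inj L"
    unfolding linear_injective_0[OF \<open>linear L\<close>]
  proof (intro allI impI)
    fix b assume L0: "L b = 0"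
    have \<pi>b: "(\<Sum>k\<in>UNIV. \<pi> k * b $ k) = 0" using \<pi>_L[of b] L0 by simp
    have harm: "b $ i = (\<Sum>j\<in>UNIV. q i j * b $ j)" for i
      using arg_cong[OF L0, of "\<lambda>v. v $ i"] \<pi>b by (simp add: L_def)
    \<comment> \<open>Maximum principle: where a harmonic b attains its maximum, so does it at every
      successor of positive probability, and by irreducibility everywhere.\<close>
    define m where "m = Max (range (($) b))"
    have le: "b $ i \<le> m" for i unfolding m_def by simp
    have "m \<in> range (($) b)" unfolding m_def by (rule Max_in) auto
    then obtain i0 where i0: "b $ i0 = m" by auto
    have "b $ j = m" for j
      using q_irr[of i0 j]
    proof (induction rule: rtrancl_induct)
      case (step i j)
      have "(\<Sum>j\<in>UNIV. q i j * (m - b $ j)) = 0"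
        using harm[of i] step q_sum[of i] by (simp add: right_diff_distrib sum_subtractf flip: sum_distrib_right)
      then have "q i j * (m - b $ j) = 0"
        using le q_nonneg by (subst (asm) sum_nonneg_eq_0_iff) auto
      then show ?case using step by auto
    qed (rule i0)
    then have "b = (\<chi> j. m)" by (simp add: vec_eq_iff)
    moreover from this have "m = 0" using \<pi>b \<pi>_sum by (simp flip: sum_distrib_right)
    ultimately show "b = 0" by (simp add: vec_eq_iff)
  qed
  ultimately have "surj L" by (rule linear_injective_imp_surjective) simp
  then obtain b where b: "L b = (\<chi> i. w i)" by (metis surj_def)
  have "(\<Sum>k\<in>UNIV. \<pi> k * b $ k) = (\<Sum>i\<in>UNIV. \<pi> i * w i)"
    using \<pi>_L[of b] b by simp
  then have "w i + (\<Sum>j\<in>UNIV. q i j * b $ j) - b $ i = (\<Sum>i\<in>UNIV. \<pi> i * w i)" for i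
    using arg_cong[OF b, of "\<lambda>v. v $ i"] by (simp add: L_def)
  then show thesis by (rule that)
qed

text \<open>\<open>a\<close> cancels the drift of order 1, \<open>b\<close> adjusts the drift of
  order 1/x. The denominator 1 + x keeps the correction bounded down to height 0.\<close>

definition corrected_height :: "('s \<Rightarrow> real) \<Rightarrow> ('s \<Rightarrow> real) \<Rightarrow> real \<times> 's \<Rightarrow> real" where
  "corrected_height a b w = fst w + a (snd w) + b (snd w) / (1 + fst w)"

section \<open>Moments of one increment of the corrected height\<close>

lemma abs_le_one_plus_sq: "\<bar>t\<bar> \<le> 1 + t\<^sup>2" for t :: real
  using zero_le_power2[of "\<bar>t\<bar> - 1"] by (auto simp: power2_diff)

lemma sq_add_le: "(s + t)\<^sup>2 \<le> 2 * s\<^sup>2 + 2 * t\<^sup>2" for s t :: real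
  using zero_le_power2[of "s - t"] by (simp add: power2_diff power2_sum)

lemma corrected_height_bound:
  assumes "fst w \<ge> 0" "\<And>j. \<bar>a j\<bar> \<le> A" "\<And>j. \<bar>b j\<bar> \<le> A"
  shows "\<bar>corrected_height a b w - fst w\<bar> \<le> 2 * A"
proof -
  have "\<bar>b (snd w)\<bar> * 1 \<le> A * (1 + fst w)" using assms by (intro mult_mono) (auto intro: order_trans[OF abs_ge_zero])
  then have "\<bar>b (snd w) / (1 + fst w)\<bar> \<le> A" using assms(1) by (simp add: abs_divide divide_le_eq)
  then show ?thesis using assms(2)[of "snd w"] unfolding corrected_height_def by linarith
qed

text \<open>A single step from the state (x, i). The estimates hold at every height, with constants
  depending only on \<open>p\<close>, \<open>C\<close> and \<open>A\<close>, so that limits along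
  lines can be taken afterwards.\<close>

locale strip_increment =
  fixes P :: "(real \<times> 's::finite) pmf" and x p C A :: real and i :: 's and a b :: "'s \<Rightarrow> real"
  assumes x_nonneg: "x \<ge> 0" and supp: "\<And>w. w \<in> set_pmf P \<Longrightarrow> fst w \<ge> 0"
    and p_gt: "p > 2" and C_nonneg: "C \<ge> 0"
    and mom: "(\<integral>\<^sup>+ w. ennreal (\<bar>fst w - x\<bar> powr p) \<partial>measure_pmf P) \<le> ennreal C"
    and a_le: "\<And>j. \<bar>a j\<bar> \<le> A" and b_le: "\<And>j. \<bar>b j\<bar> \<le> A"
begin

abbreviation "E \<equiv> measure_pmf.expectation P"
abbreviation "\<Delta> w \<equiv> fst w - x"
abbreviation "D w \<equiv> corrected_height a b w - corrected_height a b (x, i)"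

lemma A_nonneg: "A \<ge> 0" using a_le[of i] by linarith

lemma p_moment: "integrable (measure_pmf P) (\<lambda>w. \<bar>\<Delta> w\<bar> powr p)" "E (\<lambda>w. \<bar>\<Delta> w\<bar> powr p) \<le> C"
proof -
  show int: "integrable (measure_pmf P) (\<lambda>w. \<bar>\<Delta> w\<bar> powr p)"
    by (rule integrableI_bounded) (use mom in \<open>auto simp: order_le_less_trans\<close>)
  have "ennreal (E (\<lambda>w. \<bar>\<Delta> w\<bar> powr p)) \<le> ennreal C"
    using mom by (subst nn_integral_eq_integral[symmetric]) (use int in auto)
  then show "E (\<lambda>w. \<bar>\<Delta> w\<bar> powr p) \<le> C" using C_nonneg by (simp add: ennreal_le_iff)
qed

lemma integrable_sq: "integrable (measure_pmf P) (\<lambda>w. (\<Delta> w)\<^sup>2)"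
  and E_sq: "E (\<lambda>w. (\<Delta> w)\<^sup>2) \<le> 1 + C"
proof -
  have le: "(\<Delta> w)\<^sup>2 \<le> 1 + \<bar>\<Delta> w\<bar> powr p" for w
  proof (cases "\<bar>\<Delta> w\<bar> \<le> 1")
    case True
    then have "(\<Delta> w)\<^sup>2 \<le> 1" by (simp add: abs_square_le_1)
    then show ?thesis by (smt (verit) powr_ge_zero)
  next
    case False
    then have "\<bar>\<Delta> w\<bar> powr 2 \<le> \<bar>\<Delta> w\<bar> powr p" using p_gt by (intro powr_mono) auto
    then show ?thesis using False by (simp add: powr_numeral)
  qed
  show int: "integrable (measure_pmf P) (\<lambda>w. (\<Delta> w)\<^sup>2)"
    by (rule Bochner_Integration.integrable_bound[where f = "\<lambda>w. 1 + \<bar>\<Delta> w\<bar> powr p"])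
      (use p_moment le in auto)
  have "E (\<lambda>w. (\<Delta> w)\<^sup>2) \<le> E (\<lambda>w. 1 + \<bar>\<Delta> w\<bar> powr p)"
    using int p_moment le by (intro integral_mono) auto
  also have "\<dots> \<le> 1 + C" using p_moment by simp
  finally show "E (\<lambda>w. (\<Delta> w)\<^sup>2) \<le> 1 + C" .
qed

lemma integrable_dominated:
  assumes "\<And>w. w \<in> set_pmf P \<Longrightarrow> \<bar>g w\<bar> \<le> c1 + c2 * (\<Delta> w)\<^sup>2"
  shows "integrable (measure_pmf P) g"
proof (rule Bochner_Integration.integrable_bound[where f = "\<lambda>w. c1 + c2 * (\<Delta> w)\<^sup>2"])
  show "AE w in measure_pmf P. norm (g w) \<le> norm (c1 + c2 * (\<Delta> w)\<^sup>2)"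
    unfolding AE_measure_pmf_iff real_norm_def using assms by (meson abs_ge_self order_trans)
qed (use integrable_sq in auto)

lemma E_dominated:
  assumes g: "\<And>w. w \<in> set_pmf P \<Longrightarrow> \<bar>g w\<bar> \<le> c1 + c2 * (\<Delta> w)\<^sup>2" and "c2 \<ge> 0"
  shows "\<bar>E g\<bar> \<le> c1 + c2 * (1 + C)"
proof -
  have "\<bar>E g\<bar> \<le> E (\<lambda>w. \<bar>g w\<bar>)" by (rule integral_abs_bound)
  also have "\<dots> \<le> E (\<lambda>w. c1 + c2 * (\<Delta> w)\<^sup>2)"
    using g integrable_dominated[OF g] integrable_sq
    by (intro integral_mono_AE) (auto simp: AE_measure_pmf_iff)
  also have "\<dots> = c1 + c2 * E (\<lambda>w. (\<Delta> w)\<^sup>2)" using integrable_sq by simp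
  also have "\<dots> \<le> c1 + c2 * (1 + C)" using E_sq \<open>c2 \<ge> 0\<close> by (simp add: mult_left_mono)
  finally show ?thesis .
qed

lemma integrable_\<Delta>: "integrable (measure_pmf P) \<Delta>"
  by (rule integrable_dominated[where ?c1.0 = 1 and ?c2.0 = 1]) (use abs_le_one_plus_sq in auto)

lemma integrable_label: "integrable (measure_pmf P) (\<lambda>w. f (snd w) :: real)"
proof (rule integrable_dominated[where ?c1.0 = "Max (range (\<lambda>j. \<bar>f j\<bar>))" and ?c2.0 = 0])
qed simp

lemma integrable_\<Delta>_label: "integrable (measure_pmf P) (\<lambda>w. \<Delta> w * f (snd w))"
proof (rule integrable_dominated)
  let ?m = "Max (range (\<lambda>j. \<bar>f j\<bar>))"
  fix w
  have "\<bar>\<Delta> w * f (snd w)\<bar> \<le> (1 + (\<Delta> w)\<^sup>2) * ?m"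
    unfolding abs_mult using abs_le_one_plus_sq by (intro mult_mono) auto
  then show "\<bar>\<Delta> w * f (snd w)\<bar> \<le> ?m + ?m * (\<Delta> w)\<^sup>2" by (simp add: algebra_simps)
qed

text \<open>Splitting over the finitely many labels turns expectations of label functions into
  combinations of the one-step quantities \<open>qx\<close> and \<open>muijx\<close>.\<close>

lemma label_sum: "f j = (\<Sum>k\<in>UNIV. f k * (if j = k then 1 else 0 :: real))" for j :: 's
  by (simp add: if_distrib cong: if_cong)

lemma E_label: "E (\<lambda>w. f (snd w)) = (\<Sum>j\<in>UNIV. f j * measure_pmf.prob P {w. snd w = j})"
proof -
  have *: "f (snd w) = (\<Sum>j\<in>UNIV. f j * indicator {w. snd w = j} w)" for w :: "real \<times> 's"
    by (subst label_sum[of f]) (simp only: indicator_def mem_Collect_eq of_bool_def)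
  have "integrable (measure_pmf P) (indicat_real {w. snd w = j})" for j
    by (simp add: integrable_real_indicator measure_pmf.emeasure_eq_measure)
  then show ?thesis unfolding * by (subst Bochner_Integration.integral_sum) simp_all
qed

lemma E_\<Delta>_label: "E (\<lambda>w. \<Delta> w * f (snd w)) = (\<Sum>j\<in>UNIV. f j * E (\<lambda>w. \<Delta> w * (if snd w = j then 1 else 0)))"
proof -
  have *: "\<Delta> w * f (snd w) = (\<Sum>j\<in>UNIV. f j * (\<Delta> w * (if snd w = j then 1 else 0)))" for w
    by (subst label_sum[of f]) (simp add: sum_distrib_left mult_ac)
  show ?thesis unfolding *
    using integrable_\<Delta>_label[of "\<lambda>k. if k = j then 1 else 0" for j] by simp
qed

text \<open>A long downward jump can make 1 / (1 + \<open>fst w\<close>) of order 1. The inequality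
  1 + x \<le> (1 + |\<Delta>|) (1 + \<open>fst w\<close>) charges this to the size of the jump, and
  the error remains of order x^-2 in mean.\<close>

lemma inverse_shift:
  assumes "w \<in> set_pmf P"
  shows "1 / (1 + fst w) \<le> (1 + \<bar>\<Delta> w\<bar>) / (1 + x)"
    "\<bar>1 / (1 + fst w) - 1 / (1 + x)\<bar> \<le> (1 + 2 * (\<Delta> w)\<^sup>2) / (1 + x)\<^sup>2"
proof -
  have X: "fst w \<ge> 0" using supp assms by auto
  have "1 + x \<le> (1 + fst w) + \<bar>\<Delta> w\<bar> * 1" unfolding mult_1_right by linarith
  also have "\<dots> \<le> (1 + fst w) + \<bar>\<Delta> w\<bar> * (1 + fst w)" using X by (intro add_left_mono mult_left_mono) auto
  finally have "1 + x \<le> (1 + \<bar>\<Delta> w\<bar>) * (1 + fst w)" by (simp add: algebra_simps)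
  then show 1: "1 / (1 + fst w) \<le> (1 + \<bar>\<Delta> w\<bar>) / (1 + x)"
    using X x_nonneg by (simp add: divide_le_eq le_divide_eq mult.commute)
  have "\<bar>1 / (1 + fst w) - 1 / (1 + x)\<bar> = \<bar>\<Delta> w\<bar> / (1 + x) * (1 / (1 + fst w))"
    using X x_nonneg by (simp add: diff_frac_eq abs_divide abs_mult abs_minus_commute mult.commute)
  also have "\<dots> \<le> \<bar>\<Delta> w\<bar> / (1 + x) * ((1 + \<bar>\<Delta> w\<bar>) / (1 + x))"
    using x_nonneg by (intro mult_left_mono 1) auto
  also have "\<dots> = (\<bar>\<Delta> w\<bar> + (\<Delta> w)\<^sup>2) / (1 + x)\<^sup>2"
    by (simp add: power2_eq_square algebra_simps flip: abs_mult)
  also have "\<dots> \<le> (1 + 2 * (\<Delta> w)\<^sup>2) / (1 + x)\<^sup>2"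
    using abs_le_one_plus_sq[of "\<Delta> w"] by (intro divide_right_mono) auto
  finally show "\<bar>1 / (1 + fst w) - 1 / (1 + x)\<bar> \<le> (1 + 2 * (\<Delta> w)\<^sup>2) / (1 + x)\<^sup>2" .
qed

lemma D_le:
  assumes "w \<in> set_pmf P" shows "\<bar>D w\<bar> \<le> \<bar>\<Delta> w\<bar> + 4 * A"
  using corrected_height_bound[of w a A b] corrected_height_bound[of "(x, i)" a A b]
    supp[OF assms] x_nonneg a_le b_le by (simp add: abs_le_iff) linarith

lemma D_sq_le:
  assumes "w \<in> set_pmf P" shows "(D w)\<^sup>2 \<le> 32 * A\<^sup>2 + 2 * (\<Delta> w)\<^sup>2"
proof -
  have "(D w)\<^sup>2 \<le> (\<bar>\<Delta> w\<bar> + 4 * A)\<^sup>2" using D_le[OF assms] by (simp add: abs_le_square_iff[symmetric])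
  also have "\<dots> \<le> 32 * A\<^sup>2 + 2 * (\<Delta> w)\<^sup>2"
    using sq_add_le[of "\<bar>\<Delta> w\<bar>" "4 * A"] by (simp add: power_mult_distrib)
  finally show ?thesis .
qed

lemma integrable_D_sq: "integrable (measure_pmf P) (\<lambda>w. (D w)\<^sup>2)"
  by (rule integrable_dominated[where ?c1.0 = "32 * A\<^sup>2" and ?c2.0 = 2]) (use D_sq_le in auto)

lemma integrable_D: "integrable (measure_pmf P) D"
proof (rule integrable_dominated)
  fix w assume "w \<in> set_pmf P"
  then show "\<bar>D w\<bar> \<le> (1 + 4 * A) + 1 * (\<Delta> w)\<^sup>2" using D_le[of w] abs_le_one_plus_sq[of "\<Delta> w"] by linarith
qed

lemma E_D_sq_le: "E (\<lambda>w. (D w)\<^sup>2) \<le> 32 * A\<^sup>2 + 2 * (1 + C)"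
  using E_dominated[of "\<lambda>w. (D w)\<^sup>2" "32 * A\<^sup>2" 2] D_sq_le by simp

text \<open>The denominator of \<open>b\<close> is frozen at 1 + x. The remainder \<open>?g\<close>
  is of order x^-2 in mean, hence negligible even after multiplication by x.\<close>

lemma E_D:
  "\<bar>E D - (E \<Delta> + (\<Sum>j\<in>UNIV. a j * measure_pmf.prob P {w. snd w = j}) - a i
     + ((\<Sum>j\<in>UNIV. b j * measure_pmf.prob P {w. snd w = j}) - b i) / (1 + x))\<bar>
   \<le> A * (3 + 2 * C) / (1 + x)\<^sup>2"
proof -
  let ?g = "\<lambda>w. b (snd w) * (1 / (1 + fst w) - 1 / (1 + x))"
  have g: "\<bar>?g w\<bar> \<le> A / (1 + x)\<^sup>2 + A * 2 / (1 + x)\<^sup>2 * (\<Delta> w)\<^sup>2" if "w \<in> set_pmf P" for w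
  proof -
    have "\<bar>?g w\<bar> \<le> A * ((1 + 2 * (\<Delta> w)\<^sup>2) / (1 + x)\<^sup>2)"
      unfolding abs_mult using inverse_shift(2)[OF that] b_le A_nonneg by (intro mult_mono) auto
    then show ?thesis by (simp add: add_divide_distrib algebra_simps)
  qed
  have "D w = \<Delta> w + a (snd w) - a i + (b (snd w) - b i) / (1 + x) + ?g w" for w
    by (simp add: corrected_height_def right_diff_distrib diff_divide_distrib)
  then have "E D = E \<Delta> + E (\<lambda>w. a (snd w)) - a i + (E (\<lambda>w. b (snd w)) - b i) / (1 + x) + E ?g"
    using integrable_dominated[OF g] by (simp add: integrable_\<Delta> integrable_label)
  moreover have "\<bar>E ?g\<bar> \<le> A / (1 + x)\<^sup>2 + A * 2 / (1 + x)\<^sup>2 * (1 + C)"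
    using A_nonneg by (intro E_dominated[OF g]) auto
  moreover have "A / (1 + x)\<^sup>2 + A * 2 / (1 + x)\<^sup>2 * (1 + C) = A * (3 + 2 * C) / (1 + x)\<^sup>2"
    by (simp add: add_divide_distrib[symmetric] algebra_simps)
  ultimately show ?thesis by (simp add: E_label)
qed

text \<open>The \<open>b\<close> part \<open>?r\<close> of the increment is of order 1/x up to a
  factor linear in the jump, so only the square of \<open>?D0\<close>, the increment corrected by
  \<open>a\<close>, survives in the limit.\<close>

lemma E_D_sq:
  "\<bar>E (\<lambda>w. (D w)\<^sup>2) - (E (\<lambda>w. (\<Delta> w)\<^sup>2)
     + 2 * (\<Sum>j\<in>UNIV. a j * E (\<lambda>w. \<Delta> w * (if snd w = j then 1 else 0))) - 2 * a i * E \<Delta>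
     + (\<Sum>j\<in>UNIV. (a j)\<^sup>2 * measure_pmf.prob P {w. snd w = j})
     - 2 * a i * (\<Sum>j\<in>UNIV. a j * measure_pmf.prob P {w. snd w = j}) + (a i)\<^sup>2)\<bar>
   \<le> A * (2 + 6 * A) * (10 + 2 * C) / (1 + x)"
proof -
  let ?D0 = "\<lambda>w. \<Delta> w + a (snd w) - a i"
  let ?r = "\<lambda>w. b (snd w) / (1 + fst w) - b i / (1 + x)"
  let ?g = "\<lambda>w. ?r w * (2 * ?D0 w + ?r w)"
  let ?k = "A * (2 + 6 * A) / (1 + x)"
  have g: "\<bar>?g w\<bar> \<le> ?k * 8 + (?k * 2) * (\<Delta> w)\<^sup>2" if w: "w \<in> set_pmf P" for w
  proof -
    have X: "fst w \<ge> 0" using supp w by auto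
    have "\<bar>b (snd w)\<bar> * (1 / (1 + fst w)) \<le> A * ((1 + \<bar>\<Delta> w\<bar>) / (1 + x))"
      using inverse_shift(1)[OF w] b_le A_nonneg X by (intro mult_mono) auto
    moreover have "\<bar>b i\<bar> * (1 / (1 + x)) \<le> A * (1 / (1 + x))"
      using b_le x_nonneg by (intro mult_right_mono) auto
    moreover have "\<bar>?r w\<bar> \<le> \<bar>b (snd w)\<bar> * (1 / (1 + fst w)) + \<bar>b i\<bar> * (1 / (1 + x))"
      using abs_triangle_ineq4[of "b (snd w) / (1 + fst w)" "b i / (1 + x)"] X x_nonneg
      by (simp add: abs_divide)
    moreover have "A * ((1 + \<bar>\<Delta> w\<bar>) / (1 + x)) + A * (1 / (1 + x)) = A * (2 + \<bar>\<Delta> w\<bar>) / (1 + x)"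
      by (simp add: add_divide_distrib[symmetric] algebra_simps)
    ultimately have r1: "\<bar>?r w\<bar> \<le> A * (2 + \<bar>\<Delta> w\<bar>) / (1 + x)" by linarith
    have div_le: "\<bar>b j / (1 + u)\<bar> \<le> A" if "u \<ge> 0" for j u
    proof -
      have "\<bar>b j\<bar> * 1 \<le> A * (1 + u)" using that b_le A_nonneg by (intro mult_mono) auto
      then show ?thesis using that by (simp add: abs_divide divide_le_eq)
    qed
    \<comment> \<open>\<open>r1\<close> supplies the decay in x; the crude \<open>r2\<close> serves
      the other factor of \<open>?g\<close>. In 6 A below, 4 A comes from \<open>a\<close> and 2 A
      from \<open>?r\<close>.\<close>
    have r2: "\<bar>?r w\<bar> \<le> 2 * A"
      using div_le[OF X, of "snd w"] div_le[OF x_nonneg, of i] by linarith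
    have "\<bar>2 * ?D0 w + ?r w\<bar> \<le> 2 * \<bar>\<Delta> w\<bar> + 6 * A"
      using r2 a_le[of "snd w"] a_le[of i] by argo
    also have "\<dots> \<le> (2 + 6 * A) * (2 + \<bar>\<Delta> w\<bar>)"
      using A_nonneg by (simp add: algebra_simps)
    finally have "\<bar>?g w\<bar> \<le> A * (2 + \<bar>\<Delta> w\<bar>) / (1 + x) * ((2 + 6 * A) * (2 + \<bar>\<Delta> w\<bar>))"
      unfolding abs_mult using r1 A_nonneg x_nonneg by (intro mult_mono) auto
    also have "\<dots> = ?k * (2 + \<bar>\<Delta> w\<bar>)\<^sup>2" by (simp add: power2_eq_square)
    also have "\<dots> \<le> ?k * (8 + 2 * (\<Delta> w)\<^sup>2)"
      using sq_add_le[of 2 "\<bar>\<Delta> w\<bar>"] A_nonneg x_nonneg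
      by (intro mult_left_mono) auto
    also have "\<dots> = ?k * 8 + (?k * 2) * (\<Delta> w)\<^sup>2" by (simp only: distrib_left mult.assoc)
    finally show ?thesis .
  qed
  have D0: "(?D0 w)\<^sup>2 = (\<Delta> w)\<^sup>2 + 2 * (\<Delta> w * a (snd w)) - 2 * a i * \<Delta> w + (a (snd w))\<^sup>2
      - 2 * a i * a (snd w) + (a i)\<^sup>2" for w
    by (simp add: power2_eq_square algebra_simps)
  have "(D w)\<^sup>2 = (?D0 w)\<^sup>2 + ?g w" for w
    by (simp add: corrected_height_def power2_eq_square algebra_simps)
  then have "E (\<lambda>w. (D w)\<^sup>2) = E (\<lambda>w. (\<Delta> w)\<^sup>2) + 2 * E (\<lambda>w. \<Delta> w * a (snd w)) - 2 * a i * E \<Delta>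
     + E (\<lambda>w. (a (snd w))\<^sup>2) - 2 * a i * E (\<lambda>w. a (snd w)) + (a i)\<^sup>2 + E ?g"
    using integrable_dominated[OF g] integrable_sq integrable_\<Delta>_label[of a] integrable_\<Delta>
      integrable_label[of a] integrable_label[of "\<lambda>j. (a j)\<^sup>2"] by (simp add: D0)
  moreover have "\<bar>E ?g\<bar> \<le> ?k * 8 + (?k * 2) * (1 + C)"
    using A_nonneg x_nonneg by (intro E_dominated[OF g]) auto
  moreover have "?k * 8 + (?k * 2) * (1 + C) = A * (2 + 6 * A) * (10 + 2 * C) / (1 + x)"
    by (simp add: add_divide_distrib[symmetric] algebra_simps)
  ultimately show ?thesis
    by (simp add: E_label[of a] E_label[of "\<lambda>j. (a j)\<^sup>2"] E_\<Delta>_label)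
qed

text \<open>Since 4 A \<le> L/2, an increment above L forces a height jump above L/2 and is at most
  twice that jump. Trading \<Delta>^2 for |\<Delta>|^p then gains (L/2)^(2-p), which tends to 0
  because p > 2.\<close>

lemma E_D_tail:
  assumes "L > 0" "L \<ge> 8 * A"
  shows "E (\<lambda>w. (D w)\<^sup>2 * indicator {L<..} \<bar>D w\<bar>) \<le> 4 * C * (L / 2) powr (2 - p)"
proof -
  have le: "(D w)\<^sup>2 * indicator {L<..} \<bar>D w\<bar> \<le> 4 * (L / 2) powr (2 - p) * \<bar>\<Delta> w\<bar> powr p"
    if w: "w \<in> set_pmf P" for w
  proof (cases "\<bar>D w\<bar> > L")
    case True
    then have d: "\<bar>\<Delta> w\<bar> > L / 2" "\<bar>D w\<bar> \<le> 2 * \<bar>\<Delta> w\<bar>" using D_le[OF w] assms by argo+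
    have "(D w)\<^sup>2 \<le> (2 * \<bar>\<Delta> w\<bar>)\<^sup>2"
      using d(2) by (subst abs_le_square_iff[symmetric]) simp
    also have "\<dots> = 4 * (\<bar>\<Delta> w\<bar> powr 2)"
      using d assms by (simp add: powr_numeral power_mult_distrib)
    also have "\<bar>\<Delta> w\<bar> powr 2 = \<bar>\<Delta> w\<bar> powr (2 - p) * \<bar>\<Delta> w\<bar> powr p"
      by (simp add: powr_add[symmetric])
    also have "\<dots> \<le> (L / 2) powr (2 - p) * \<bar>\<Delta> w\<bar> powr p"
      using d assms p_gt by (intro mult_right_mono powr_mono2') auto
    finally show ?thesis using True by (simp add: indicator_def)
  qed (simp add: indicator_def)
  have int: "integrable (measure_pmf P) (\<lambda>w. (D w)\<^sup>2 * indicator {L<..} \<bar>D w\<bar>)"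
    by (rule Bochner_Integration.integrable_bound[OF integrable_D_sq]) (auto simp: indicator_def)
  have "E (\<lambda>w. (D w)\<^sup>2 * indicator {L<..} \<bar>D w\<bar>) \<le> E (\<lambda>w. 4 * (L / 2) powr (2 - p) * \<bar>\<Delta> w\<bar> powr p)"
    using le int p_moment by (intro integral_mono_AE) (auto simp: AE_measure_pmf_iff)
  also have "\<dots> \<le> 4 * (L / 2) powr (2 - p) * C"
    using p_moment by (simp add: mult_left_mono)
  finally show ?thesis by (simp add: mult_ac)
qed

end

lemma along_at_top: "filterlim (\<lambda>x. x) at_top (along Sig i)"
  unfolding along_def filterlim_def by (simp add: filtermap_ident)

lemma eventually_along_uniform:
  fixes Q :: "'s::finite \<Rightarrow> real \<Rightarrow> bool"
  assumes "\<And>i. eventually (Q i) (along Sig i)"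
  shows "\<exists>x0. \<forall>i x. (x, i) \<in> Sig \<longrightarrow> x0 < x \<longrightarrow> Q i x"
proof -
  have "\<forall>i. eventually (\<lambda>x. (x, i) \<in> Sig \<longrightarrow> Q i x) at_top"
    using assms by (simp add: along_def eventually_inf_principal line_def)
  then have "eventually (\<lambda>x. \<forall>i. (x, i) \<in> Sig \<longrightarrow> Q i x) at_top"
    by (simp add: eventually_all_finite)
  then show ?thesis unfolding eventually_at_top_dense by blast
qed

text \<open>Holds because the positive part of u - h is at most |max 0 u - h|. It bounds the
  one-step growth of a squared downward displacement whatever the sign of u.\<close>

lemma max_sq_shift: "(max 0 (u - h))\<^sup>2 \<le> (max 0 u)\<^sup>2 - 2 * max 0 u * h + h\<^sup>2" for u h :: real
proof -
  have "(max 0 (u - h))\<^sup>2 \<le> (max 0 u - h)\<^sup>2"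
    by (simp add: abs_le_square_iff[symmetric])
  then show ?thesis by (simp add: power2_diff)
qed

section \<open>The Lamperti strip\<close>

text \<open>Here \<open>b\<close> is any bounded correction; that it solves the Poisson equation
  enters later, as the hypothesis \<open>UV\<close> of single lemmas.\<close>

locale lamperti_strip =
  fixes Sig :: "(real \<times> 's::finite) set" and K :: "real \<times> 's \<Rightarrow> (real \<times> 's) pmf"
    and p C A :: real and q \<gamma> dd :: "'s \<Rightarrow> 's \<Rightarrow> real" and d e t2 a b :: "'s \<Rightarrow> real"
  assumes Sig_pos: "Sig \<subseteq> {0..} \<times> UNIV" and K_on: "kernel_on Sig K"
    and p_gt: "p > 2" and C_nonneg: "C \<ge> 0"
    and moment: "\<And>z. z \<in> Sig \<Longrightarrow> (\<integral>\<^sup>+ w. ennreal (\<bar>fst w - fst z\<bar> powr p) \<partial>measure_pmf (K z)) \<le> ennreal C"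
    and QG_lim: "\<And>i j. (\<lambda>x. qx K i j x - q i j - \<gamma> i j / x) \<in> o[along Sig i](\<lambda>x. 1 / x)"
    and DG_mu: "\<And>i. (\<lambda>x. mux K i x - d i - e i / x) \<in> o[along Sig i](\<lambda>x. 1 / x)"
    and DG_sigma: "\<And>i. (sigma2x K i \<longlongrightarrow> t2 i) (along Sig i)"
    and DG_muij: "\<And>i j. (muijx K i j \<longlongrightarrow> dd i j) (along Sig i)"
    and a_eq: "\<And>i. d i + (\<Sum>j\<in>UNIV. a j * q i j) - a i = 0"
    and a_le: "\<And>j. \<bar>a j\<bar> \<le> A" and b_le: "\<And>j. \<bar>b j\<bar> \<le> A"
begin

abbreviation "\<psi> \<equiv> corrected_height a b"

definition mean where "mean z = measure_pmf.expectation (K z) (\<lambda>w. \<psi> w - \<psi> z)"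
definition msq where "msq z = measure_pmf.expectation (K z) (\<lambda>w. (\<psi> w - \<psi> z)\<^sup>2)"

lemma A_nonneg: "A \<ge> 0" using a_le[of undefined] by linarith

lemma Sig_nonneg: "z \<in> Sig \<Longrightarrow> fst z \<ge> 0"
  using Sig_pos by (cases z) auto

lemma closed: "z \<in> Sig \<Longrightarrow> set_pmf (K z) \<subseteq> Sig"
  using K_on by (auto simp: kernel_on_def)

lemma \<psi>_bound: "z \<in> Sig \<Longrightarrow> \<bar>\<psi> z - fst z\<bar> \<le> 2 * A"
  using corrected_height_bound[of z a A b] Sig_nonneg a_le b_le by blast

lemma increment:
  assumes z: "(x, i) \<in> Sig" shows "strip_increment (K (x, i)) x p C A a b"
proof
  show "x \<ge> 0" using Sig_nonneg[OF z] by simp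
  show "fst w \<ge> 0" if "w \<in> set_pmf (K (x, i))" for w
    using closed[OF z] Sig_nonneg that by blast
  show "(\<integral>\<^sup>+ w. ennreal (\<bar>fst w - x\<bar> powr p) \<partial>measure_pmf (K (x, i))) \<le> ennreal C"
    using moment[OF z] by simp
qed (fact p_gt C_nonneg a_le b_le)+

lemma eventually_Sig: "eventually (\<lambda>x. (x, i) \<in> Sig) (along Sig i)"
  unfolding along_def eventually_inf_principal by (simp add: line_def)

lemma eventually_pos: "eventually (\<lambda>x. x > 0) (along Sig i)"
  using along_at_top[of Sig i] by (simp add: filterlim_at_top_dense)

lemma tendsto_along:
  assumes "(f \<longlongrightarrow> l) at_top" shows "(f \<longlongrightarrow> l) (along Sig i)"
  using filterlim_compose[OF assms along_at_top] .

lemma qx_lim: "((\<lambda>x. x * (qx K i j x - q i j - \<gamma> i j / x)) \<longlongrightarrow> 0) (along Sig i)"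
  using smalloD_tendsto[OF QG_lim[of i j]] by (simp add: mult.commute)

lemma mux_lim: "((\<lambda>x. x * (mux K i x - d i - e i / x)) \<longlongrightarrow> 0) (along Sig i)"
  using smalloD_tendsto[OF DG_mu[of i]] by (simp add: mult.commute)

lemma first_order_limit:
  assumes "((\<lambda>x. x * (f x - u - v / x)) \<longlongrightarrow> (0::real)) (along Sig i)"
  shows "(f \<longlongrightarrow> u) (along Sig i)"
proof -
  have inv: "((\<lambda>x. 1 / x) \<longlongrightarrow> (0::real)) (along Sig i)"
    by (rule tendsto_along) real_asymp
  have "((\<lambda>x. x * (f x - u - v / x) * (1 / x) + u + v * (1 / x)) \<longlongrightarrow> 0 * 0 + u + v * 0) (along Sig i)"
    by (intro tendsto_intros assms inv)
  moreover have "eventually (\<lambda>x. x * (f x - u - v / x) * (1 / x) + u + v * (1 / x) = f x) (along Sig i)"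
    using eventually_pos by eventually_elim simp
  ultimately show ?thesis by (simp add: tendsto_cong)
qed

text \<open>\<open>G\<close> is the expansion of the mean from \<open>E_D\<close>. In x G the terms
  of order x add up to x (d_i + \<Sum>_j a_j q_ij - a_i) = 0; \<open>G'\<close> is the rearrangement
  in which each summand has a limit.\<close>

lemma mean_lim:
  "((\<lambda>x. x * mean (x, i)) \<longlongrightarrow> e i + (\<Sum>j\<in>UNIV. a j * \<gamma> i j) + (\<Sum>j\<in>UNIV. q i j * b j) - b i) (along Sig i)"
proof -
  define G where "G x = mux K i x + (\<Sum>j\<in>UNIV. a j * qx K i j x) - a i
    + ((\<Sum>j\<in>UNIV. b j * qx K i j x) - b i) / (1 + x)" for x
  define G' where "G' x = x * (mux K i x - d i - e i / x)
    + (\<Sum>j\<in>UNIV. a j * (x * (qx K i j x - q i j - \<gamma> i j / x))) + (e i + (\<Sum>j\<in>UNIV. a j * \<gamma> i j))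
    + ((\<Sum>j\<in>UNIV. b j * qx K i j x) - b i) * (x / (1 + x))" for x
  have "((\<lambda>x::real. x / (1 + x)) \<longlongrightarrow> 1) at_top" by real_asymp
  then have "(G' \<longlongrightarrow> 0 + (\<Sum>j\<in>UNIV. a j * 0) + (e i + (\<Sum>j\<in>UNIV. a j * \<gamma> i j))
      + ((\<Sum>j\<in>UNIV. b j * q i j) - b i) * 1) (along Sig i)"
    unfolding G'_def by (intro tendsto_intros mux_lim qx_lim first_order_limit[OF qx_lim] tendsto_along)
  moreover have "eventually (\<lambda>x. G' x = x * G x) (along Sig i)"
    using eventually_pos
  proof eventually_elim
    case (elim x)
    have S: "(\<Sum>j\<in>UNIV. a j * (x * (qx K i j x - q i j - \<gamma> i j / x)))
      = x * (\<Sum>j\<in>UNIV. a j * qx K i j x) - x * (a i - d i) - (\<Sum>j\<in>UNIV. a j * \<gamma> i j)"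
    proof -
      have Q: "a i - d i = (\<Sum>j\<in>UNIV. a j * q i j)" using a_eq[of i] by simp
      have "a j * (x * (qx K i j x - q i j - \<gamma> i j / x)) = x * (a j * qx K i j x) - x * (a j * q i j) - a j * \<gamma> i j" for j
        using elim by (simp add: field_simps)
      then show ?thesis unfolding Q by (simp only: sum_subtractf sum_distrib_left)
    qed
    have "x * (mux K i x - d i - e i / x) = x * mux K i x - x * d i - e i"
      using elim by (simp add: field_simps)
    then show ?case unfolding G_def G'_def S by (simp add: algebra_simps diff_divide_distrib)
  qed
  ultimately have lim: "((\<lambda>x. x * G x) \<longlongrightarrow> e i + (\<Sum>j\<in>UNIV. a j * \<gamma> i j) + (\<Sum>j\<in>UNIV. q i j * b j) - b i) (along Sig i)"
    by (simp add: tendsto_cong algebra_simps)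
  have "((\<lambda>x. x * mean (x, i) - x * G x) \<longlongrightarrow> 0) (along Sig i)"
  proof (rule Lim_null_comparison)
    show "((\<lambda>x. A * (3 + 2 * C) * (x / (1 + x)\<^sup>2)) \<longlongrightarrow> 0) (along Sig i)"
      by (intro tendsto_mult_right_zero tendsto_along) real_asymp
    show "eventually (\<lambda>x. norm (x * mean (x, i) - x * G x) \<le> A * (3 + 2 * C) * (x / (1 + x)\<^sup>2)) (along Sig i)"
      using eventually_pos eventually_Sig
    proof eventually_elim
      case (elim x)
      interpret strip_increment "K (x, i)" x p C A i a b by (rule increment[OF elim(2)])
      have "\<bar>mean (x, i) - G x\<bar> \<le> A * (3 + 2 * C) / (1 + x)\<^sup>2"
        using E_D by (simp add: mean_def G_def mux_def qx_def)
      then have "x * \<bar>mean (x, i) - G x\<bar> \<le> x * (A * (3 + 2 * C) / (1 + x)\<^sup>2)"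
        using elim by (intro mult_left_mono) auto
      moreover have "norm (x * mean (x, i) - x * G x) = x * \<bar>mean (x, i) - G x\<bar>"
        using elim by (simp add: abs_mult flip: right_diff_distrib)
      ultimately show ?case by (simp add: mult_ac)
    qed
  qed
  from tendsto_add[OF this lim] show ?thesis by simp
qed

text \<open>By \<open>a_eq\<close> the cross terms -2 a_i d_i - 2 a_i \<Sum>_j a_j q_ij equal -2
  a_i^2. The leftover \<Sum>_j a_j^2 q_ij - a_i^2 has average 0 under the stationary
  distribution.\<close>

lemma msq_lim:
  "((\<lambda>x. msq (x, i)) \<longlongrightarrow> t2 i + 2 * (\<Sum>j\<in>UNIV. a j * dd i j) + (\<Sum>j\<in>UNIV. (a j)\<^sup>2 * q i j) - (a i)\<^sup>2) (along Sig i)"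
proof -
  define G where "G x = sigma2x K i x + 2 * (\<Sum>j\<in>UNIV. a j * muijx K i j x) - 2 * a i * mux K i x
     + (\<Sum>j\<in>UNIV. (a j)\<^sup>2 * qx K i j x) - 2 * a i * (\<Sum>j\<in>UNIV. a j * qx K i j x) + (a i)\<^sup>2" for x
  have "(G \<longlongrightarrow> t2 i + 2 * (\<Sum>j\<in>UNIV. a j * dd i j) - 2 * a i * d i
     + (\<Sum>j\<in>UNIV. (a j)\<^sup>2 * q i j) - 2 * a i * (\<Sum>j\<in>UNIV. a j * q i j) + (a i)\<^sup>2) (along Sig i)"
    unfolding G_def
    by (intro tendsto_intros DG_sigma DG_muij first_order_limit[OF qx_lim] first_order_limit[OF mux_lim])
  moreover have "t2 i + 2 * (\<Sum>j\<in>UNIV. a j * dd i j) - 2 * a i * d i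
     + (\<Sum>j\<in>UNIV. (a j)\<^sup>2 * q i j) - 2 * a i * (\<Sum>j\<in>UNIV. a j * q i j) + (a i)\<^sup>2
    = t2 i + 2 * (\<Sum>j\<in>UNIV. a j * dd i j) + (\<Sum>j\<in>UNIV. (a j)\<^sup>2 * q i j) - (a i)\<^sup>2"
  proof -
    have S: "(\<Sum>j\<in>UNIV. a j * q i j) = a i - d i" using a_eq[of i] by simp
    show ?thesis unfolding S by algebra
  qed
  ultimately have lim: "(G \<longlongrightarrow> t2 i + 2 * (\<Sum>j\<in>UNIV. a j * dd i j) + (\<Sum>j\<in>UNIV. (a j)\<^sup>2 * q i j) - (a i)\<^sup>2) (along Sig i)"
    by (simp only:)
  have "((\<lambda>x. msq (x, i) - G x) \<longlongrightarrow> 0) (along Sig i)"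
  proof (rule Lim_null_comparison)
    show "((\<lambda>x. A * (2 + 6 * A) * (10 + 2 * C) * (1 / (1 + x))) \<longlongrightarrow> 0) (along Sig i)"
      by (intro tendsto_mult_right_zero tendsto_along) real_asymp
    show "eventually (\<lambda>x. norm (msq (x, i) - G x) \<le> A * (2 + 6 * A) * (10 + 2 * C) * (1 / (1 + x))) (along Sig i)"
      using eventually_Sig
    proof eventually_elim
      case (elim x)
      interpret strip_increment "K (x, i)" x p C A i a b by (rule increment[OF elim])
      show ?case using E_D_sq by (simp add: msq_def G_def mux_def qx_def muijx_def sigma2x_def)
    qed
  qed
  from tendsto_add[OF this lim] show ?thesis by simp
qed

section \<open>Submartingale above a level and survival for times of order r^2\<close>

definition V2 where "V2 = 32 * A\<^sup>2 + 2 * (1 + C)"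

lemma V2_pos: "V2 > 0" using C_nonneg by (simp add: V2_def add_nonneg_pos)

lemma msq_le: "z \<in> Sig \<Longrightarrow> msq z \<le> V2"
proof (cases z)
  case (Pair x i)
  assume "z \<in> Sig"
  then interpret strip_increment "K (x, i)" x p C A i a b using Pair by (intro increment) simp
  show ?thesis using E_D_sq_le by (simp add: Pair msq_def V2_def)
qed

lemma integrable_increment:
  assumes "z \<in> Sig"
  shows "integrable (measure_pmf (K z)) (\<lambda>w. \<psi> w - \<psi> z)" "integrable (measure_pmf (K z)) (\<lambda>w. (\<psi> w - \<psi> z)\<^sup>2)"
proof -
  obtain x i where z: "z = (x, i)" by (cases z)
  interpret strip_increment "K (x, i)" x p C A i a b using assms z by (intro increment) simp
  show "integrable (measure_pmf (K z)) (\<lambda>w. \<psi> w - \<psi> z)" "integrable (measure_pmf (K z)) (\<lambda>w. (\<psi> w - \<psi> z)\<^sup>2)"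
    using integrable_D integrable_D_sq by (simp_all add: z)
qed

lemma mean_bound: "\<exists>C1>0. \<exists>x0. \<forall>z\<in>Sig. x0 < fst z \<longrightarrow> fst z * \<bar>mean z\<bar> \<le> C1"
proof -
  define m where "m i = e i + (\<Sum>j\<in>UNIV. a j * \<gamma> i j) + (\<Sum>j\<in>UNIV. q i j * b j) - b i" for i
  define C1 where "C1 = Max (range (\<lambda>i. \<bar>m i\<bar>)) + 1"
  have m_le: "\<bar>m i\<bar> < C1" for i
    unfolding C1_def by (rule order_le_less_trans[of _ "Max (range (\<lambda>i. \<bar>m i\<bar>))"]) (auto intro!: Max_ge)
  have "eventually (\<lambda>x. x > 0 \<and> \<bar>x * mean (x, i)\<bar> < C1) (along Sig i)" for i
    using order_tendstoD(2)[OF tendsto_rabs[OF mean_lim, folded m_def] m_le] eventually_pos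
    by eventually_elim simp
  from eventually_along_uniform[OF this] obtain x0
    where x0: "\<And>i x. (x, i) \<in> Sig \<Longrightarrow> x0 < x \<Longrightarrow> x > 0 \<and> \<bar>x * mean (x, i)\<bar> < C1" by blast
  have "fst z * \<bar>mean z\<bar> \<le> C1" if "z \<in> Sig" "x0 < fst z" for z
    using x0[of "fst z" "snd z"] that by (auto simp: abs_mult)
  moreover have "C1 > 0" using m_le[of undefined] by linarith
  ultimately show ?thesis by blast
qed

lemma powr_submartingale:
  assumes "\<beta> > 0" "\<kappa> > 0"
    and UV: "\<And>i. e i + (\<Sum>j\<in>UNIV. a j * \<gamma> i j) + (\<Sum>j\<in>UNIV. q i j * b j) - b i
      + (\<beta> - 1) / 2 * (t2 i + 2 * (\<Sum>j\<in>UNIV. a j * dd i j) + (\<Sum>j\<in>UNIV. (a j)\<^sup>2 * q i j) - (a i)\<^sup>2) = \<kappa>"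
  shows "\<exists>x0. \<forall>z\<in>Sig. x0 < fst z \<longrightarrow>
    ennreal (max 0 (\<psi> z) powr \<beta>) \<le> (\<integral>\<^sup>+ w. ennreal (max 0 (\<psi> w) powr \<beta>) \<partial>measure_pmf (K z))"
proof -
  define \<epsilon> where "\<epsilon> = \<beta> * \<kappa> / (4 * V2)"
  define c where "c = \<beta> * (\<beta> - 1) / 2"
  have "\<epsilon> > 0" using assms V2_pos by (simp add: \<epsilon>_def)
  obtain B \<rho> where B: "B \<ge> 0" "\<rho> > 0"
    and taylor: "\<And>t. 1 + \<beta> * t + (c - \<epsilon>) * t\<^sup>2 - B * (t\<^sup>2 * indicator {\<rho><..} \<bar>t\<bar>) \<le> max 0 (1 + t) powr \<beta>"
    using powr_taylor_lower[OF assms(1) \<open>\<epsilon> > 0\<close>] unfolding c_def by metis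
  \<comment> \<open>Budget in units of \<beta>\<kappa>: the main term exceeds 3/4; replacing x by
    \<open>\<psi> z\<close> costs at most 1/4, the Taylor slack 1/4 by the choice of
    \<open>\<epsilon>\<close>, the tail 1/8. The last two conditions give
    \<open>\<psi> z > 0\<close> and allow \<open>E_D_tail\<close> with L = \<rho>
    \<open>\<psi> z\<close>.\<close>
  have ev: "eventually (\<lambda>x. \<beta> * (x * mean (x, i)) + c * msq (x, i) > 3 / 4 * (\<beta> * \<kappa>)
      \<and> \<beta> * (2 * A) * \<bar>mean (x, i)\<bar> < \<beta> * \<kappa> / 4
      \<and> B * (4 * C) * (\<rho> * (x - 2 * A) / 2) powr (2 - p) < \<beta> * \<kappa> / 8
      \<and> x > 2 * A \<and> \<rho> * (x - 2 * A) \<ge> 8 * A) (along Sig i)" for i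
  proof (intro eventually_conj)
    let ?m = "e i + (\<Sum>j\<in>UNIV. a j * \<gamma> i j) + (\<Sum>j\<in>UNIV. q i j * b j) - b i"
    let ?v = "t2 i + 2 * (\<Sum>j\<in>UNIV. a j * dd i j) + (\<Sum>j\<in>UNIV. (a j)\<^sup>2 * q i j) - (a i)\<^sup>2"
    have "((\<lambda>x. \<beta> * (x * mean (x, i)) + c * msq (x, i)) \<longlongrightarrow> \<beta> * ?m + c * ?v) (along Sig i)"
      by (intro tendsto_intros mean_lim msq_lim)
    moreover have "\<beta> * ?m + c * ?v = \<beta> * (?m + (\<beta> - 1) / 2 * ?v)" by (simp only: c_def) algebra
    ultimately have "((\<lambda>x. \<beta> * (x * mean (x, i)) + c * msq (x, i)) \<longlongrightarrow> \<beta> * \<kappa>) (along Sig i)"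
      using UV[of i] by simp
    then show "eventually (\<lambda>x. \<beta> * (x * mean (x, i)) + c * msq (x, i) > 3 / 4 * (\<beta> * \<kappa>)) (along Sig i)"
      by (rule order_tendstoD(1)) (use assms in simp)
    have inv: "((\<lambda>x. 1 / x) \<longlongrightarrow> (0::real)) (along Sig i)"
      by (rule tendsto_along) real_asymp
    have "((\<lambda>x. \<beta> * (2 * A) * \<bar>x * mean (x, i) * (1 / x)\<bar>) \<longlongrightarrow> \<beta> * (2 * A) * \<bar>?m * 0\<bar>) (along Sig i)"
      by (intro tendsto_intros mean_lim inv)
    then have "eventually (\<lambda>x. \<beta> * (2 * A) * \<bar>x * mean (x, i) * (1 / x)\<bar> < \<beta> * \<kappa> / 4) (along Sig i)"
      by (rule order_tendstoD(2)) (use assms in simp)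
    then show "eventually (\<lambda>x. \<beta> * (2 * A) * \<bar>mean (x, i)\<bar> < \<beta> * \<kappa> / 4) (along Sig i)"
      using eventually_pos by eventually_elim simp
    have "((\<lambda>x. (\<rho> * (x - 2 * A) / 2) powr (2 - p)) \<longlongrightarrow> 0) at_top"
    proof (rule tendsto_neg_powr)
      show "filterlim (\<lambda>x. \<rho> * (x - 2 * A) / 2) at_top at_top"
        using B by real_asymp
    qed (use p_gt in simp)
    then have "((\<lambda>x. B * (4 * C) * (\<rho> * (x - 2 * A) / 2) powr (2 - p)) \<longlongrightarrow> 0) (along Sig i)"
      by (intro tendsto_mult_right_zero tendsto_along)
    then show "eventually (\<lambda>x. B * (4 * C) * (\<rho> * (x - 2 * A) / 2) powr (2 - p) < \<beta> * \<kappa> / 8) (along Sig i)"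
      by (rule order_tendstoD(2)) (use assms in simp)
    show "eventually (\<lambda>x. x > 2 * A) (along Sig i)"
      using along_at_top[of Sig i] by (simp add: filterlim_at_top_dense)
    have "eventually (\<lambda>x. x \<ge> 8 * A / \<rho> + 2 * A) (along Sig i)"
      using along_at_top[of Sig i] by (simp add: filterlim_at_top)
    then show "eventually (\<lambda>x. \<rho> * (x - 2 * A) \<ge> 8 * A) (along Sig i)"
      by eventually_elim (use B in \<open>simp add: field_simps\<close>)
  qed
  from eventually_along_uniform[OF this] obtain x0 where
    x0: "\<And>i x. (x, i) \<in> Sig \<Longrightarrow> x0 < x \<Longrightarrow> \<beta> * (x * mean (x, i)) + c * msq (x, i) > 3 / 4 * (\<beta> * \<kappa>)
      \<and> \<beta> * (2 * A) * \<bar>mean (x, i)\<bar> < \<beta> * \<kappa> / 4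
      \<and> B * (4 * C) * (\<rho> * (x - 2 * A) / 2) powr (2 - p) < \<beta> * \<kappa> / 8
      \<and> x > 2 * A \<and> \<rho> * (x - 2 * A) \<ge> 8 * A" by blast
  have "ennreal (max 0 (\<psi> z) powr \<beta>) \<le> (\<integral>\<^sup>+ w. ennreal (max 0 (\<psi> w) powr \<beta>) \<partial>measure_pmf (K z))"
    if z: "z \<in> Sig" "x0 < fst z" for z
  proof -
    obtain x i where zx: "z = (x, i)" by (cases z)
    interpret strip_increment "K (x, i)" x p C A i a b using z zx by (intro increment) simp
    have h: "\<beta> * (x * mean z) + c * msq z > 3 / 4 * (\<beta> * \<kappa>)"
      "\<beta> * (2 * A) * \<bar>mean z\<bar> < \<beta> * \<kappa> / 4"
      "B * (4 * C) * (\<rho> * (x - 2 * A) / 2) powr (2 - p) < \<beta> * \<kappa> / 8"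
      "x > 2 * A" "\<rho> * (x - 2 * A) \<ge> 8 * A" using x0[of x i] z zx by auto
    have \<psi>z: "\<bar>\<psi> z - x\<bar> \<le> 2 * A" using \<psi>_bound[OF z(1)] zx by simp
    then have y: "\<psi> z \<ge> x - 2 * A" by linarith
    let ?T = "measure_pmf.expectation (K z) (\<lambda>w. (\<psi> w - \<psi> z)\<^sup>2 * indicator {\<rho> * \<psi> z<..} \<bar>\<psi> w - \<psi> z\<bar>)"
    have \<rho>y: "\<rho> * (x - 2 * A) \<le> \<rho> * \<psi> z" using y B by (intro mult_left_mono) auto
    have \<rho>x: "0 < \<rho> * (x - 2 * A)" using h B by simp
    have "?T \<le> 4 * C * (\<rho> * \<psi> z / 2) powr (2 - p)"
      using E_D_tail[of "\<rho> * \<psi> z"] \<rho>y \<rho>x h(5) zx by simp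
    also have "\<dots> \<le> 4 * C * (\<rho> * (x - 2 * A) / 2) powr (2 - p)"
      using \<rho>y \<rho>x p_gt C_nonneg by (intro mult_left_mono powr_mono2') auto
    finally have "B * ?T \<le> B * (4 * C * (\<rho> * (x - 2 * A) / 2) powr (2 - p))"
      using B by (intro mult_left_mono)
    then have T: "B * ?T < \<beta> * \<kappa> / 8" using h(3) by (simp add: mult.assoc)
    have "\<epsilon> * msq z \<le> \<epsilon> * V2" using msq_le[OF z(1)] \<open>\<epsilon> > 0\<close> by (intro mult_left_mono) auto
    also have "\<epsilon> * V2 = \<beta> * \<kappa> / 4" using V2_pos by (simp add: \<epsilon>_def)
    finally have S: "\<epsilon> * msq z \<le> \<beta> * \<kappa> / 4" .
    have "\<bar>(\<psi> z - x) * mean z\<bar> \<le> 2 * A * \<bar>mean z\<bar>"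
      unfolding abs_mult by (intro mult_right_mono \<psi>z) auto
    then have "(\<psi> z - x) * mean z \<ge> - (2 * A * \<bar>mean z\<bar>)" by linarith
    then have "\<beta> * ((\<psi> z - x) * mean z) \<ge> \<beta> * (- (2 * A * \<bar>mean z\<bar>))"
      using assms(1) by (intro mult_left_mono) auto
    then have "\<beta> * \<psi> z * mean z \<ge> \<beta> * (x * mean z) - \<beta> * (2 * A) * \<bar>mean z\<bar>"
      by (simp add: algebra_simps)
    moreover have "\<beta> * \<kappa> > 0" using assms by simp
    moreover have "(c - \<epsilon>) * msq z = c * msq z - \<epsilon> * msq z" by (simp add: algebra_simps)
    ultimately have "0 \<le> \<beta> * \<psi> z * mean z + (c - \<epsilon>) * msq z - B * ?T"
      using h(1,2) T S by linarith
    then show ?thesis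
      using h(4) y integrable_increment[OF z(1)]
      by (intro powr_submartingale_step[OF taylor]) (auto simp: mean_def msq_def)
  qed
  then show ?thesis by blast
qed

text \<open>The potential is the squared downward displacement from the start: it is 0 initially,
  grows in mean by at most 8 C1 + V2 per step, and is at least r^2 / 16 on exit. The bound on n
  limits the mean growth to half of that.\<close>

lemma survival_half:
  assumes C1: "C1 > 0" and mean_le: "\<And>w. w \<in> Sig \<Longrightarrow> r / 2 < fst w \<Longrightarrow> fst w * \<bar>mean w\<bar> \<le> C1"
    and z: "z \<in> Sig" "fst z = r" and r: "r > 0" "r \<ge> 16 * A"
    and n: "real n \<le> r\<^sup>2 / (32 * (8 * C1 + V2))"
  shows "ennreal (1 / 2) \<le> survival K {w. r / 2 < fst w} n z"
proof -
  let ?\<phi> = "\<lambda>w. (max 0 (\<psi> z - \<psi> w))\<^sup>2"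
  have C2: "8 * C1 + V2 > 0" using C1 V2_pos by simp
  have \<psi>z: "\<bar>\<psi> z - r\<bar> \<le> 2 * A" using \<psi>_bound[OF z(1)] z(2) by simp
  have bound: "?\<phi> w \<le> ?\<phi> v - 2 * max 0 (\<psi> z - \<psi> v) * (\<psi> w - \<psi> v) + (\<psi> w - \<psi> v)\<^sup>2" for v w
    using max_sq_shift[of "\<psi> z - \<psi> v" "\<psi> w - \<psi> v"] by simp
  have int: "integrable (measure_pmf (K v)) ?\<phi>" if "v \<in> Sig" for v
  proof (rule Bochner_Integration.integrable_bound)
    show "integrable (measure_pmf (K v))
      (\<lambda>w. ?\<phi> v - 2 * max 0 (\<psi> z - \<psi> v) * (\<psi> w - \<psi> v) + (\<psi> w - \<psi> v)\<^sup>2)"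
      using integrable_increment[OF that] by simp
    show "AE w in measure_pmf (K v). norm (?\<phi> w)
      \<le> norm (?\<phi> v - 2 * max 0 (\<psi> z - \<psi> v) * (\<psi> w - \<psi> v) + (\<psi> w - \<psi> v)\<^sup>2)"
      unfolding real_norm_def abs_power2 by (intro AE_I2 order_trans[OF bound abs_ge_self])
  qed simp
  have "ennreal (1 - (?\<phi> z + (8 * C1 + V2) * real n) / (r\<^sup>2 / 16)) \<le> survival K {w. r / 2 < fst w} n z"
  proof (rule survival_ge[where S = Sig and \<phi> = ?\<phi>])
    show "r\<^sup>2 / 16 \<le> ?\<phi> v" if v: "v \<in> Sig - {w. r / 2 < fst w}" for v
    proof -
      have "\<bar>\<psi> v - fst v\<bar> \<le> 2 * A" using v by (intro \<psi>_bound) simp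
      \<comment> \<open>The height drops by at least r/2; the two corrections cost 4 A \<le>
        r/4.\<close>
      then have "r / 4 \<le> \<psi> z - \<psi> v" using \<psi>z v r by (simp add: abs_le_iff)
      also have "\<dots> \<le> max 0 (\<psi> z - \<psi> v)" by simp
      finally have "r / 4 \<le> max 0 (\<psi> z - \<psi> v)" .
      then have "(r / 4)\<^sup>2 \<le> ?\<phi> v" by (rule power_mono) (use r in simp)
      then show ?thesis by (simp add: power_divide)
    qed
    show "measure_pmf.expectation (K v) ?\<phi> \<le> ?\<phi> v + (8 * C1 + V2)" if v: "v \<in> Sig \<inter> {w. r / 2 < fst w}" for v
    proof -
      define u where "u = max 0 (\<psi> z - \<psi> v)"
      have "measure_pmf.expectation (K v) ?\<phi>
        \<le> measure_pmf.expectation (K v) (\<lambda>w. ?\<phi> v - 2 * u * (\<psi> w - \<psi> v) + (\<psi> w - \<psi> v)\<^sup>2)"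
        unfolding u_def using v integrable_increment[of v] by (intro integral_mono int bound) simp_all
      also have "\<dots> = ?\<phi> v - 2 * u * mean v + msq v"
        using v integrable_increment[of v] by (simp add: mean_def msq_def)
      finally have E: "measure_pmf.expectation (K v) ?\<phi> \<le> ?\<phi> v - 2 * u * mean v + msq v" .
      have "\<bar>\<psi> v - fst v\<bar> \<le> 2 * A" using v by (intro \<psi>_bound) simp
      then have u: "0 \<le> u" "u \<le> 2 * r" using \<psi>z r v A_nonneg by (simp_all add: u_def abs_le_iff)
      \<comment> \<open>Above r/2 the drift is at most 2 C1 / r while the displacement is at most 2
        r, so the cross term is bounded independently of r.\<close>
      have "r / 2 * \<bar>mean v\<bar> \<le> fst v * \<bar>mean v\<bar>" using v by (intro mult_right_mono) auto
      also have "\<dots> \<le> C1" using mean_le v by simp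
      finally have "r * \<bar>mean v\<bar> \<le> 2 * C1" by simp
      moreover have "u * \<bar>mean v\<bar> \<le> 2 * r * \<bar>mean v\<bar>" by (intro mult_right_mono u(2)) simp
      moreover have "u * (- mean v) \<le> u * \<bar>mean v\<bar>" using u(1) by (intro mult_left_mono) auto
      ultimately have "- (2 * u * mean v) \<le> 8 * C1" by simp
      then show ?thesis using E msq_le[of v] v by simp
    qed
  qed (use closed r C2 int z in auto)
  moreover have "1 / 2 \<le> 1 - (?\<phi> z + (8 * C1 + V2) * real n) / (r\<^sup>2 / 16)"
    using n r C2 by (simp add: field_simps)
  ultimately show ?thesis by (meson ennreal_leI order_trans)
qed

text \<open>Started at height r, the walk stays above r/2 for order r^2 steps with probability at
  least 1/2; this bounds the sum below by a multiple of r^(2\<theta>).\<close>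
lemma survival_sum_ge_powr:
  assumes "\<theta> > 0" and C1: "C1 > 0" and x: "x > 0" "x \<ge> 8 * A"
    and mean_le: "\<And>w. w \<in> Sig \<Longrightarrow> x < fst w \<Longrightarrow> fst w * \<bar>mean w\<bar> \<le> C1"
  shows "\<exists>k>0. \<forall>z\<in>Sig \<inter> {w. x < fst w}.
    ennreal k * ennreal (max 0 (\<psi> z) powr (2 * \<theta>)) \<le> (\<Sum>m. powr_incr \<theta> m * survival K {w. x < fst w} m z)"
proof -
  define C2 where "C2 = 32 * (8 * C1 + V2)"
  have C2: "C2 > 0" using C1 V2_pos by (simp add: C2_def)
  define k1 where "k1 = 1 / (2 * x + 2 * A) powr (2 * \<theta>)"
  define k2 where "k2 = 1 / 2 * (1 / C2) powr \<theta> / 2 powr (2 * \<theta>)"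
  have k: "k1 > 0" "k2 > 0" using x A_nonneg C2 by (simp_all add: k1_def k2_def)
  have "ennreal (min k1 k2) * ennreal (max 0 (\<psi> z) powr (2 * \<theta>))
      \<le> (\<Sum>m. powr_incr \<theta> m * survival K {w. x < fst w} m z)" (is "?L \<le> ?R")
    if z: "z \<in> Sig" "x < fst z" for z
  proof -
    define r where "r = fst z"
    have \<psi>z: "\<bar>\<psi> z - r\<bar> \<le> 2 * A" using \<psi>_bound[OF z(1)] by (simp add: r_def)
    have L: "?L = ennreal (min k1 k2 * max 0 (\<psi> z) powr (2 * \<theta>))"
      using k by (simp add: ennreal_mult)
    have R: "(\<Sum>m<N. powr_incr \<theta> m * survival K {w. x < fst w} m z) \<le> ?R" for N
      by (rule sum_le_suminf) auto
    show ?thesis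
    proof (cases "r \<le> 2 * x")
      \<comment> \<open>On this bounded range of heights the term m = 0, which equals 1, is enough;
        \<open>k1\<close> scales the left side down to it.\<close>
      case True
      have "max 0 (\<psi> z) powr (2 * \<theta>) \<le> (2 * x + 2 * A) powr (2 * \<theta>)"
        using True \<psi>z x A_nonneg assms(1) by (intro powr_mono2) auto
      then have "min k1 k2 * max 0 (\<psi> z) powr (2 * \<theta>) \<le> k1 * (2 * x + 2 * A) powr (2 * \<theta>)"
        using k by (intro mult_mono) auto
      also have "\<dots> = 1" using x A_nonneg by (simp add: k1_def)
      finally have "?L \<le> 1" unfolding L by simp
      also have "1 = (\<Sum>m<1. powr_incr \<theta> m * survival K {w. x < fst w} m z)"
        using z assms(1) by (simp add: powr_incr_def survival_0)
      also have "\<dots> \<le> ?R" by (rule R)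
      finally show ?thesis .
    next
      case False
      \<comment> \<open>Each m \<le> N is short enough for \<open>survival_half\<close>, and the N +
        1 weights telescope to (N+1)^\<theta> \<ge> (r^2/C2)^\<theta>. The factor 2^(2\<theta>) in
        \<open>k2\<close> covers \<open>\<psi> z\<close> \<le> r + 2 A \<le> 2 r; r > 2 x places r/2
        above x.\<close>
      define N where "N = nat \<lfloor>r\<^sup>2 / C2\<rfloor>"
      have N: "real N \<le> r\<^sup>2 / C2" "r\<^sup>2 / C2 \<le> real (Suc N)"
        using C2 unfolding N_def by (simp_all add: of_nat_floor) linarith
      have "min k1 k2 * max 0 (\<psi> z) powr (2 * \<theta>) \<le> k2 * (2 * r) powr (2 * \<theta>)"
        using k False \<psi>z x A_nonneg assms(1) by (intro mult_mono powr_mono2) auto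
      also have "\<dots> = 1 / 2 * (r\<^sup>2 / C2) powr \<theta>"
      proof -
        have "(r\<^sup>2 / C2) powr \<theta> = (r powr 2) powr \<theta> * (1 / C2) powr \<theta>"
          using False x C2 by (simp add: powr_mult[symmetric] powr_numeral)
        also have "(r powr 2) powr \<theta> = r powr (2 * \<theta>)" by (simp add: powr_powr)
        finally show ?thesis using False x by (simp add: k2_def powr_mult)
      qed
      also have "\<dots> \<le> 1 / 2 * real (Suc N) powr \<theta>"
        using N(2) C2 assms(1) by (intro mult_left_mono powr_mono2) auto
      finally have "?L \<le> ennreal (1 / 2 * real (Suc N) powr \<theta>)" unfolding L by (rule ennreal_leI)
      also have "\<dots> = ennreal (real (Suc N) powr \<theta>) * ennreal (1 / 2)"
        by (subst ennreal_mult[symmetric]) (simp_all add: mult.commute)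
      also have "\<dots> = (\<Sum>m<Suc N. powr_incr \<theta> m * ennreal (1 / 2))"
        by (simp only: sum_powr_incr[OF assms(1), symmetric] sum_distrib_right)
      also have "\<dots> \<le> (\<Sum>m<Suc N. powr_incr \<theta> m * survival K {w. x < fst w} m z)"
      proof (intro sum_mono mult_left_mono)
        fix m assume "m \<in> {..<Suc N}"
        then have m: "real m \<le> r\<^sup>2 / C2" using N(1) by (simp add: less_Suc_eq_le)
        have "ennreal (1 / 2) \<le> survival K {w. r / 2 < fst w} m z"
          using C1 mean_le z False x m by (intro survival_half) (auto simp: r_def C2_def)
        also have "\<dots> \<le> survival K {w. x < fst w} m z"
          using False by (intro survival_mono_set) auto
        finally show "ennreal (1 / 2) \<le> survival K {w. x < fst w} m z" .
      qed simp
      also have "\<dots> \<le> ?R" by (rule R)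
      finally show ?thesis .
    qed
  qed
  moreover have "min k1 k2 > 0" using k by simp
  ultimately show ?thesis by (intro exI[of _ "min k1 k2"]) auto
qed

lemma hitting_moment_infinite:
  assumes "\<theta> > 0" "\<kappa> > 0"
    and UV: "\<And>i. e i + (\<Sum>j\<in>UNIV. a j * \<gamma> i j) + (\<Sum>j\<in>UNIV. q i j * b j) - b i
      + (2 * \<theta> - 1) / 2 * (t2 i + 2 * (\<Sum>j\<in>UNIV. a j * dd i j) + (\<Sum>j\<in>UNIV. (a j)\<^sup>2 * q i j) - (a i)\<^sup>2) = \<kappa>"
  shows "\<exists>y>x. \<forall>z0\<in>Sig. y \<le> fst z0 \<longrightarrow> (\<forall>s\<ge>\<theta>. \<forall>(M :: 'w measure) Z. markov_chain_from M Z K z0 \<longrightarrow>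
    (\<integral>\<^sup>+ \<omega>. hitting_time_pow x s Z \<omega> \<partial>M) = \<infinity>)"
proof -
  let ?f = "\<lambda>z. ennreal (max 0 (\<psi> z) powr (2 * \<theta>))"
  obtain C1 x1 where C1: "C1 > 0" "\<And>z. z \<in> Sig \<Longrightarrow> x1 < fst z \<Longrightarrow> fst z * \<bar>mean z\<bar> \<le> C1"
    using mean_bound by blast
  obtain x2 where x2: "\<And>z. z \<in> Sig \<Longrightarrow> x2 < fst z \<Longrightarrow> ?f z \<le> (\<integral>\<^sup>+ w. ?f w \<partial>measure_pmf (K z))"
    using powr_submartingale[of "2 * \<theta>", OF _ assms(2) UV] assms(1) by auto
  define x' where "x' = Max {x, x1, x2, 8 * A, 1}"
  have x': "x \<le> x'" "x1 \<le> x'" "x2 \<le> x'" "8 * A \<le> x'" "1 \<le> x'" by (simp_all add: x'_def)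
  obtain k where k: "k > 0" "\<And>z. z \<in> Sig \<inter> {w. x' < fst w} \<Longrightarrow>
      ennreal k * ?f z \<le> (\<Sum>m. powr_incr \<theta> m * survival K {w. x' < fst w} m z)"
    using survival_sum_ge_powr[of \<theta> C1 x'] assms(1) C1 x' by fastforce
  have inf: "(\<Sum>m. powr_incr \<theta> m * survival K {w. x' < fst w} m z0) = \<infinity>"
    if z0: "z0 \<in> Sig" "x' + 4 * A + 1 \<le> fst z0" for z0
  proof (rule survival_sum_infinite[where S = Sig and f = ?f and B = "ennreal ((x' + 2 * A) powr (2 * \<theta>))"])
    show "?f z \<le> (\<integral>\<^sup>+ w. ?f w \<partial>measure_pmf (K z))" if "z \<in> Sig \<inter> {w. x' < fst w}" for z
      using x2[of z] that x' by simp
    show "?f z \<le> ennreal ((x' + 2 * A) powr (2 * \<theta>))" if "z \<in> Sig - {w. x' < fst w}" for z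
      using that \<psi>_bound[of z] assms(1) x' A_nonneg by (intro ennreal_leI powr_mono2) auto
    \<comment> \<open>The corrected height is at most x' + 2 A below x' and at least x' + 2 A + 1 at
      the start. This threshold does not involve s.\<close>
    have "x' + 2 * A < max 0 (\<psi> z0)" using z0 \<psi>_bound[of z0] by simp
    then show "ennreal ((x' + 2 * A) powr (2 * \<theta>)) < ?f z0"
      using assms(1) x' A_nonneg by (intro ennreal_lessI powr_less_mono2) auto
    show "0 < ennreal k" using k(1) by simp
  qed (use closed k(2) z0 suminf_powr_incr[OF assms(1)] in auto)
  show ?thesis
  proof (intro exI conjI ballI impI allI)
    show "x < x' + 4 * A + 1" using x' A_nonneg by simp
    fix z0 s and M :: "'w measure" and Z
    assume "z0 \<in> Sig" "x' + 4 * A + 1 \<le> fst z0" "\<theta> \<le> s" "markov_chain_from M Z K z0"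
    then show "(\<integral>\<^sup>+ \<omega>. hitting_time_pow x s Z \<omega> \<partial>M) = \<infinity>"
      using inf x' assms(1) by (intro hitting_time_infinite[of M Z K z0 \<theta> s x x'])
  qed
qed

end

theorem theorem2p8:
  fixes Sig :: "(real \<times> 's::finite) set"
    and K :: "real \<times> 's \<Rightarrow> (real \<times> 's) pmf"
    and p Cp \<theta> :: real
    and q \<gamma> dd :: "'s \<Rightarrow> 's \<Rightarrow> real"
    and \<pi> d e t2 a :: "'s \<Rightarrow> real"
  assumes Sig_pos: "Sig \<subseteq> {0..} \<times> UNIV"
    and Sig_lf: "locally_finite_states Sig"
    and K_on: "kernel_on Sig K"
    and irred: "irreducible_kernel Sig K"
    and unbounded: "\<forall>k. \<not> bdd_above (line Sig k)"
    and p_gt: "p > 2"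
    and moment: "\<forall>z\<in>Sig. (\<integral>\<^sup>+ w. ennreal (\<bar>fst w - fst z\<bar> powr p) \<partial>measure_pmf (K z)) \<le> ennreal Cp"
    and QG_q: "irreducible_stochastic q" "stationary_dist q \<pi>"
    and QG_lim: "\<forall>i j. (\<lambda>x. qx K i j x - q i j - \<gamma> i j / x) \<in> o[along Sig i](\<lambda>x. 1 / x)"
    and DG_mu: "\<forall>i. (\<lambda>x. mux K i x - d i - e i / x) \<in> o[along Sig i](\<lambda>x. 1 / x)"
    and DG_sigma: "\<forall>i. (sigma2x K i \<longlongrightarrow> t2 i) (along Sig i)"
    and DG_muij: "\<forall>i j. (muijx K i j \<longlongrightarrow> dd i j) (along Sig i)"
    and DG_t: "\<forall>i. t2 i \<ge> 0" "\<exists>i. t2 i \<noteq> 0"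
    and DG_drift: "(\<Sum>i\<in>UNIV. \<pi> i * d i) = 0"
    and a_sol: "\<forall>i. d i + (\<Sum>j\<in>UNIV. (a j - a i) * q i j) = 0"
    and \<theta>_range: "0 < \<theta>" "\<theta> \<le> p / 2"
    and UV: "(\<Sum>i\<in>UNIV. (2 * e i + 2 * (\<Sum>j\<in>UNIV. a j * \<gamma> i j)) * \<pi> i)
             + (2 * \<theta> - 1) * (\<Sum>i\<in>UNIV. (t2 i + 2 * (\<Sum>j\<in>UNIV. a j * dd i j)) * \<pi> i) > 0"
  shows "\<forall>s\<ge>\<theta>. \<forall>x. \<exists>y>x. \<forall>z0\<in>Sig. fst z0 \<ge> y \<longrightarrow>
           (\<forall>(M :: 'w measure) Z. markov_chain_from M Z K z0 \<longrightarrow>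
              (\<integral>\<^sup>+ \<omega>. hitting_time_pow x s Z \<omega> \<partial>M) = \<infinity>)"
proof -
  define u where "u i = e i + (\<Sum>j\<in>UNIV. a j * \<gamma> i j)" for i
  define v where "v i = t2 i + 2 * (\<Sum>j\<in>UNIV. a j * dd i j) + (\<Sum>j\<in>UNIV. (a j)\<^sup>2 * q i j) - (a i)\<^sup>2" for i
  define w where "w i = u i + (2 * \<theta> - 1) / 2 * v i" for i
  \<comment> \<open>Twice this number is U + (2\<theta> - 1) V: invariance of \<pi> removes the
    extra terms a_j^2 q_ij - a_i^2 of \<open>v\<close>.\<close>
  define \<kappa> where "\<kappa> = (\<Sum>i\<in>UNIV. \<pi> i * w i)"
  have q_sum: "(\<Sum>j\<in>UNIV. q i j) = 1" for i
    using QG_q(1) by (simp add: irreducible_stochastic_def)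
  have \<pi>_inv: "(\<Sum>i\<in>UNIV. \<pi> i * q i j) = \<pi> j" for j
    using QG_q(2) by (simp add: stationary_dist_def)
  have \<pi>_sq: "(\<Sum>i\<in>UNIV. \<pi> i * (\<Sum>j\<in>UNIV. (a j)\<^sup>2 * q i j)) = (\<Sum>j\<in>UNIV. \<pi> j * (a j)\<^sup>2)"
  proof -
    have "(\<Sum>i\<in>UNIV. \<pi> i * (\<Sum>j\<in>UNIV. (a j)\<^sup>2 * q i j)) = (\<Sum>i\<in>UNIV. \<Sum>j\<in>UNIV. \<pi> i * q i j * (a j)\<^sup>2)"
      by (simp add: sum_distrib_left mult_ac)
    also have "\<dots> = (\<Sum>j\<in>UNIV. (\<Sum>i\<in>UNIV. \<pi> i * q i j) * (a j)\<^sup>2)"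
      by (subst sum.swap) (simp add: sum_distrib_right)
    finally show ?thesis by (simp add: \<pi>_inv)
  qed
  have "(\<Sum>i\<in>UNIV. \<pi> i * v i) = (\<Sum>i\<in>UNIV. (t2 i + 2 * (\<Sum>j\<in>UNIV. a j * dd i j)) * \<pi> i)
      + (\<Sum>i\<in>UNIV. \<pi> i * (\<Sum>j\<in>UNIV. (a j)\<^sup>2 * q i j)) - (\<Sum>j\<in>UNIV. \<pi> j * (a j)\<^sup>2)"
    unfolding sum.distrib[symmetric] sum_subtractf[symmetric]
    by (intro sum.cong) (simp_all only: v_def, algebra)
  then have V: "(\<Sum>i\<in>UNIV. \<pi> i * v i) = (\<Sum>i\<in>UNIV. (t2 i + 2 * (\<Sum>j\<in>UNIV. a j * dd i j)) * \<pi> i)"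
    by (simp add: \<pi>_sq)
  have w2: "2 * (\<pi> i * w i) = (2 * e i + 2 * (\<Sum>j\<in>UNIV. a j * \<gamma> i j)) * \<pi> i + (2 * \<theta> - 1) * (\<pi> i * v i)" for i
    unfolding w_def u_def by (simp add: field_simps flip: sum_distrib_left)
  have "2 * \<kappa> = (\<Sum>i\<in>UNIV. 2 * (\<pi> i * w i))"
    by (simp only: \<kappa>_def sum_distrib_left)
  also have "\<dots> = (\<Sum>i\<in>UNIV. (2 * e i + 2 * (\<Sum>j\<in>UNIV. a j * \<gamma> i j)) * \<pi> i) + (2 * \<theta> - 1) * (\<Sum>i\<in>UNIV. \<pi> i * v i)"
    unfolding w2 by (simp only: sum.distrib sum_distrib_left[symmetric])
  finally have "\<kappa> > 0" using UV V by simp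
  \<comment> \<open>Here the line-dependent limits \<open>w\<close> are levelled to their positive
    average.\<close>
  obtain b where b: "\<And>i. w i + (\<Sum>j\<in>UNIV. q i j * b j) - b i = \<kappa>"
    using poisson_equation[OF QG_q, of w] unfolding \<kappa>_def by metis
  define A where "A = max (Max (range (\<lambda>j. \<bar>a j\<bar>))) (Max (range (\<lambda>j. \<bar>b j\<bar>)))"
  interpret lamperti_strip Sig K p "max 0 Cp" A q \<gamma> dd d e t2 a b
  proof
    show "(\<integral>\<^sup>+ w. ennreal (\<bar>fst w - fst z\<bar> powr p) \<partial>measure_pmf (K z)) \<le> ennreal (max 0 Cp)" if "z \<in> Sig" for z
      by (rule order_trans[OF bspec[OF moment that] ennreal_leI]) simp
    show "d i + (\<Sum>j\<in>UNIV. a j * q i j) - a i = 0" for i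
    proof -
      have "(\<Sum>j\<in>UNIV. (a j - a i) * q i j) = (\<Sum>j\<in>UNIV. a j * q i j) - a i * (\<Sum>j\<in>UNIV. q i j)"
        by (simp add: left_diff_distrib sum_subtractf sum_distrib_left)
      then show ?thesis using spec[OF a_sol, of i] unfolding q_sum mult_1_right by linarith
    qed
    show "\<bar>a j\<bar> \<le> A" for j unfolding A_def by (intro max.coboundedI1 Max_ge) auto
    show "\<bar>b j\<bar> \<le> A" for j unfolding A_def by (intro max.coboundedI2 Max_ge) auto
  qed (use Sig_pos K_on p_gt QG_lim DG_mu DG_sigma DG_muij in auto)
  have "e i + (\<Sum>j\<in>UNIV. a j * \<gamma> i j) + (\<Sum>j\<in>UNIV. q i j * b j) - b i
      + (2 * \<theta> - 1) / 2 * (t2 i + 2 * (\<Sum>j\<in>UNIV. a j * dd i j) + (\<Sum>j\<in>UNIV. (a j)\<^sup>2 * q i j) - (a i)\<^sup>2) = \<kappa>" for i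
    using b[of i] unfolding w_def u_def v_def by linarith
  from hitting_moment_infinite[OF \<theta>_range(1) \<open>\<kappa> > 0\<close> this, where 'w = 'w]
  show ?thesis by meson
qed

end
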